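(* Let $c\in\mathbb{C}$. Suppose that there exists a nonzero additive function $f\colon\mathbb{C}\to\mathbb{C}$ satisfying $$\sum_{i=1}^n a_i f(\alpha_i x+\beta_i y)=c\cdot(x+y)\qquad (x,y\in\mathbb{C}).$$ Then there exist a finitely generated subfield $K\subset\mathbb{C}$ containing $\alpha_i$ and $\beta_i$ $(i=1,\ldots,n)$ and an automorphism $\phi\colon\mathbb{C}\to\mathbb{C}$ which is the extension of an exponential element of $S_1^*$ (that is, $\phi|_{K^*}$ is an exponential belonging to $S_1^*$), such that $$\sum_{i=1}^n a_i\phi(\alpha_i x+\beta_i y)=\tilde c\cdot(x+y)\qquad (x,y\in K)$$ for some $\tilde c\in\mathbb{C}$. In particular, $$\sum_{i=1}^n a_i\phi(\alpha_i)=\sum_{i=1}^n a_i\phi(\beta_i)=\tilde c.$$ If $\tilde c=0$, then $$\sum_{i=1}^n a_i\phi(\alpha_i x+\beta_i y)=0\qquad (x,y\in\mathbb{C}),$$ i.e. $\phi$ is a solution of the homogeneous equation on $\mathbb{C}$. If $\tilde c\neq 0$, then $\phi(x)=x$ for all $x\in K$ and $$\sum_{i=1}^n a_i\alpha_i=\sum_{i=1}^n a_i\beta_i=\tilde c\neq 0. \qquad ( * )$$ Conversely, if $c\neq 0$ and $( * )$ holds for some $\tilde c\in\mathbb{C}$, then $f(x):=(c/\tilde c)\cdot x$ is a nonzero additive solution on $\mathbb{C}$ of $\sum_{i=1}^n a_i f(\alpha_i x+\beta_i y)=c\cdot(x+y)$.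
   Context: Standing setting: $n\in\mathbb{N}$, $a_1,\ldots,a_n\in\mathbb{C}$, and $\alpha_1,\ldots,\alpha_n,\beta_1,\ldots,\beta_n\in\mathbb{C}$ satisfy $\alpha_i+\beta_i\neq 0$ for all $i$ and $\alpha_i\beta_j-\alpha_j\beta_i\neq 0$ for all $i\neq j$. For a finitely generated subfield $K\subset\mathbb{C}$ containing all $\alpha_i,\beta_i$, let $V_1$ be the set of additive functions $K\to\mathbb{C}$ and let $S_1$ be the set of all $\tilde f\in V_1$ for which there exists $\tilde c\in\mathbb{C}$ (depending on $\tilde f$) with $\sum_{i=1}^n a_i\tilde f(\alpha_i x+\beta_i y)=\tilde c\cdot(x+y)$ for all $x,y\in K$. Let $K^*=K\setminus\{0\}$ be the multiplicative group of $K$, and $S_1^*=\{\tilde f|_{K^*}:\tilde f\in S_1\}$. An exponential on an Abelian group $(G,* )$ is a (not identically zero) function $m\colon G\to\mathbb{C}$ with $m(x*y)=m(x)m(y)$ for all $x,y\in G$. *)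

theory Defs
  imports
    Complex_Main
    "HOL-Library.FuncSet"
    "HOL-Algebra.Generated_Fields"
    "HOL-Algebra.QuotRing"
    "HOL-Algebra.Algebraic_Closure_Type"
begin

abbreviation complex_field :: "complex ring" where
  "complex_field \<equiv> ring_of_type_algebra"

definition fin_gen_subfield :: "complex set \<Rightarrow> bool" where
  "fin_gen_subfield K \<longleftrightarrow> (\<exists>S. finite S \<and> K = generate_field complex_field S)"

(* The group K^* = K - {0}. The constant mult_of is qualified because HOL-Algebra
   defines it twice (identically). *)
abbreviation mult_group :: "complex set \<Rightarrow> complex monoid" where
  "mult_group K \<equiv> Multiplicative_Group.mult_of (complex_field\<lparr>carrier := K\<rparr>)"

(* Only the values of m on the carrier matter. *)
definition exponential :: "('g, 'b) monoid_scheme \<Rightarrow> ('g \<Rightarrow> complex) \<Rightarrow> bool" where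
  "exponential G m \<longleftrightarrow>
     (\<exists>x\<in>carrier G. m x \<noteq> 0) \<and>
     (\<forall>x\<in>carrier G. \<forall>y\<in>carrier G. m (x \<otimes>\<^bsub>G\<^esub> y) = m x * m y)"

definition solves_on ::
  "complex set \<Rightarrow> nat \<Rightarrow> (nat \<Rightarrow> complex) \<Rightarrow> (nat \<Rightarrow> complex) \<Rightarrow> (nat \<Rightarrow> complex) \<Rightarrow>
   (complex \<Rightarrow> complex) \<Rightarrow> complex \<Rightarrow> bool" where
  "solves_on D n a \<alpha> \<beta> f c \<longleftrightarrow>
     (\<forall>x\<in>D. \<forall>y\<in>D. (\<Sum>i=1..n. a i * f (\<alpha> i * x + \<beta> i * y)) = c * (x + y))"

(* Functions with domain K are represented as extensional functions, so that
   restriction to a subset is the library's restrict. *)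
definition V1 :: "complex set \<Rightarrow> (complex \<Rightarrow> complex) set" where
  "V1 K = {f \<in> extensional K. \<forall>x\<in>K. \<forall>y\<in>K. f (x + y) = f x + f y}"

definition S1 ::
  "nat \<Rightarrow> (nat \<Rightarrow> complex) \<Rightarrow> (nat \<Rightarrow> complex) \<Rightarrow> (nat \<Rightarrow> complex) \<Rightarrow> complex set \<Rightarrow>
   (complex \<Rightarrow> complex) set" where
  "S1 n a \<alpha> \<beta> K = {f \<in> V1 K. \<exists>c. solves_on K n a \<alpha> \<beta> f c}"

definition S1_star ::
  "nat \<Rightarrow> (nat \<Rightarrow> complex) \<Rightarrow> (nat \<Rightarrow> complex) \<Rightarrow> (nat \<Rightarrow> complex) \<Rightarrow> complex set \<Rightarrow>
   (complex \<Rightarrow> complex) set" where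
  "S1_star n a \<alpha> \<beta> K = (\<lambda>f. restrict f (K - {0})) ` S1 n a \<alpha> \<beta> K"

end

theory Submission
  imports Defs "HOL-Analysis.Continuum_Not_Denumerable" "HOL-Library.Function_Algebras"
begin

text \<open>
  If \<open>c \<noteq> 0\<close>, evaluating \<open>\<Sum>i j. a i * a j * f (\<alpha> i * \<beta> j)\<close> in two ways gives
  \<open>\<Sum>i. a i * \<alpha> i = \<Sum>i. a i * \<beta> i\<close>, and the identity automorphism works.

  If \<open>c = 0\<close>, let \<open>K\<close> be a countable field containing the \<open>\<alpha> i\<close> and \<open>\<beta> i\<close>. The span of the dilates
  \<open>x \<mapsto> f (k * x)\<close>, \<open>k \<in> K\<close>, has countable dimension. Modulo a dilation invariant subspace that is
  maximal among those not containing \<open>f\<close>, every dilation \<open>T k\<close> acts on \<open>f\<close> as a scalar \<open>\<phi> k\<close>: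
  otherwise the resolvents \<open>(T k - w)\<inverse> f\<close>, \<open>w \<in> \<complex>\<close>, would be an uncountable linearly independent
  family. This \<open>\<phi>\<close> is a field embedding of \<open>K\<close> into \<open>\<complex>\<close> that solves the homogeneous equation.
  Back and forth turns it into an automorphism of a countable ring, which is extended by the
  identity on transcendental elements until \<open>\<complex>\<close> is algebraic over its domain, and then to \<open>\<complex>\<close>.
\<close>

section \<open>Partial isomorphisms\<close>

text \<open>
  A partial isomorphism is represented by its graph, a subring of the product ring. Its domain and
  range need not be fields, hence the use of pseudo-division for minimal polynomials.
\<close>

definition partial_iso :: "('a::comm_ring_1 \<times> 'b::comm_ring_1) set \<Rightarrow> bool" where
  "partial_iso G \<longleftrightarrow> (1, 1) \<in> G \<and>
     (\<forall>a a' b b'. (a, a') \<in> G \<longrightarrow> (b, b') \<in> G \<longrightarrow> (a - b, a' - b') \<in> G \<and> (a * b, a' * b') \<in> G) \<and>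
     (\<forall>a a'. (a, a') \<in> G \<longrightarrow> (a = 0 \<longleftrightarrow> a' = 0))"

text \<open>A relation rather than the image of \<open>p\<close> under a coefficient map, so that it
  commutes with \<open>converse\<close> and facts about ranges follow from those about
  domains.\<close>

definition coeff_rel :: "('a::zero \<times> 'b::zero) set \<Rightarrow> 'a poly \<Rightarrow> 'b poly \<Rightarrow> bool" where
  "coeff_rel G p q \<longleftrightarrow> (\<forall>i. (coeff p i, coeff q i) \<in> G)"

text \<open>For a partial isomorphism \<open>G\<close> this is the subring of the product ring
  generated by \<open>G\<close> and \<open>(x, y)\<close>. Whether it is again the graph of an
  isomorphism depends on the choice of \<open>y\<close>.\<close>

definition adjoin ::
  "('a::comm_ring_1 \<times> 'b::comm_ring_1) set \<Rightarrow> 'a \<Rightarrow> 'b \<Rightarrow> ('a \<times> 'b) set" where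
  "adjoin G x y = {(poly p x, poly q y) | p q. coeff_rel G p q}"

definition algebraic_over :: "'a::comm_ring_1 set \<Rightarrow> 'a \<Rightarrow> bool" where
  "algebraic_over D x \<longleftrightarrow> (\<exists>p. p \<noteq> 0 \<and> (\<forall>i. coeff p i \<in> D) \<and> poly p x = 0)"

lemma partial_isoD:
  assumes "partial_iso G"
  shows partial_iso_one: "(1, 1) \<in> G"
    and partial_iso_zero: "(0, 0) \<in> G"
    and partial_iso_diff: "(a, a') \<in> G \<Longrightarrow> (b, b') \<in> G \<Longrightarrow> (a - b, a' - b') \<in> G"
    and partial_iso_mult: "(a, a') \<in> G \<Longrightarrow> (b, b') \<in> G \<Longrightarrow> (a * b, a' * b') \<in> G"
    and partial_iso_add: "(a, a') \<in> G \<Longrightarrow> (b, b') \<in> G \<Longrightarrow> (a + b, a' + b') \<in> G"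
    and partial_iso_eq_0_iff: "(a, a') \<in> G \<Longrightarrow> a = 0 \<longleftrightarrow> a' = 0"
proof -
  show one: "(1, 1) \<in> G" and diff: "\<And>a a' b b'. (a, a') \<in> G \<Longrightarrow> (b, b') \<in> G \<Longrightarrow> (a - b, a' - b') \<in> G"
    and "(a, a') \<in> G \<Longrightarrow> (b, b') \<in> G \<Longrightarrow> (a * b, a' * b') \<in> G"
    and "(a, a') \<in> G \<Longrightarrow> a = 0 \<longleftrightarrow> a' = 0"
    using assms unfolding partial_iso_def by blast+
  show zero: "(0, 0) \<in> G"
    using diff[OF one one] by simp
  show "(a, a') \<in> G \<Longrightarrow> (b, b') \<in> G \<Longrightarrow> (a + b, a' + b') \<in> G"
    using diff[OF _ diff[OF zero], of a a' b b'] by simp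
qed

text \<open>The difference of the two pairs lies in \<open>G\<close>, so matching zeros already
  makes \<open>G\<close> the graph of an injective function.\<close>

lemma partial_iso_eq_iff:
  assumes "partial_iso G" "(a, a') \<in> G" "(b, b') \<in> G"
  shows "a = b \<longleftrightarrow> a' = b'"
  using partial_iso_eq_0_iff[OF assms(1) partial_iso_diff[OF assms]] by simp

lemma partial_iso_converse: "partial_iso (G\<inverse>) \<longleftrightarrow> partial_iso G"
  unfolding partial_iso_def converse_iff by blast

lemma coeff_rel_converse: "coeff_rel (G\<inverse>) q p \<longleftrightarrow> coeff_rel G p q"
  by (simp add: coeff_rel_def)

lemma adjoin_converse: "adjoin (G\<inverse>) y x = (adjoin G x y)\<inverse>"
  by (auto simp: adjoin_def coeff_rel_converse)

lemma partial_iso_sum: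
  assumes "partial_iso G" "\<And>i. i \<in> I \<Longrightarrow> (f i, g i) \<in> G"
  shows "(sum f I, sum g I) \<in> G"
  using assms(2)
  by (induction I rule: infinite_finite_induct)
     (auto intro: partial_iso_zero[OF assms(1)] partial_iso_add[OF assms(1)])

lemma partial_iso_Union:
  assumes ne: "C \<noteq> {}" and chain: "\<And>G H. G \<in> C \<Longrightarrow> H \<in> C \<Longrightarrow> G \<subseteq> H \<or> H \<subseteq> G"
    and iso: "\<And>G. G \<in> C \<Longrightarrow> partial_iso G"
  shows "partial_iso (\<Union>C)"
  unfolding partial_iso_def
proof (intro conjI allI impI)
  show "(1, 1) \<in> \<Union>C"
    using ne partial_iso_one[OF iso] by blast
next
  fix a a' b b' assume "(a, a') \<in> \<Union>C" "(b, b') \<in> \<Union>C"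
  then obtain G where G: "G \<in> C" "(a, a') \<in> G" "(b, b') \<in> G"
    using chain by blast
  then show "(a - b, a' - b') \<in> \<Union>C" "(a * b, a' * b') \<in> \<Union>C"
    using partial_iso_diff[OF iso] partial_iso_mult[OF iso] by blast+
next
  fix a a' assume "(a, a') \<in> \<Union>C"
  then show "a = 0 \<longleftrightarrow> a' = 0"
    using partial_iso_eq_0_iff[OF iso] by blast
qed

context
  fixes G :: "('a::comm_ring_1 \<times> 'b::comm_ring_1) set"
  assumes G: "partial_iso G"
begin

lemma coeff_rel_const: "(a, a') \<in> G \<Longrightarrow> coeff_rel G [:a:] [:a':]"
  by (auto simp: coeff_rel_def coeff_pCons partial_iso_zero[OF G] split: nat.split)

lemma coeff_rel_monom: "(a, a') \<in> G \<Longrightarrow> coeff_rel G (monom a n) (monom a' n)"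
  by (auto simp: coeff_rel_def partial_iso_zero[OF G])

lemma coeff_rel_diff:
  "coeff_rel G p q \<Longrightarrow> coeff_rel G r s \<Longrightarrow> coeff_rel G (p - r) (q - s)"
  by (simp add: coeff_rel_def partial_iso_diff[OF G])

lemma coeff_rel_mult:
  "coeff_rel G p q \<Longrightarrow> coeff_rel G r s \<Longrightarrow> coeff_rel G (p * r) (q * s)"
  unfolding coeff_rel_def coeff_mult
  by (intro allI partial_iso_sum[OF G] partial_iso_mult[OF G]) auto

lemma coeff_rel_eq_0_iff: "coeff_rel G p q \<Longrightarrow> p = 0 \<longleftrightarrow> q = 0"
  unfolding poly_eq_iff coeff_rel_def using partial_iso_eq_0_iff[OF G] by (metis coeff_0)

lemma coeff_rel_degree: "coeff_rel G p q \<Longrightarrow> degree p = degree q"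
proof -
  assume pq: "coeff_rel G p q"
  then have "coeff p i = 0 \<longleftrightarrow> coeff q i = 0" for i
    using partial_iso_eq_0_iff[OF G] unfolding coeff_rel_def by blast
  then show ?thesis
    unfolding degree_def by simp
qed

lemma coeff_rel_exists:
  assumes "\<And>i. coeff p i \<in> Domain G"
  obtains q where "coeff_rel G p q"
proof -
  define f where "f a = (SOME a'. (a, a') \<in> G)" for a
  have f: "(a, f a) \<in> G" if "a \<in> Domain G" for a
    using someI_ex[of "\<lambda>a'. (a, a') \<in> G"] that unfolding f_def by blast
  \<comment> \<open>Without this value \<open>map_poly f\<close> would not act coefficientwise
    beyond the degree.\<close>
  have "f 0 = 0"
    using partial_iso_eq_0_iff[OF G f[of 0]] partial_iso_zero[OF G] by blast
  then have "coeff_rel G p (map_poly f p)"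
    using f assms by (simp add: coeff_rel_def coeff_map_poly)
  then show thesis ..
qed

lemma Domain_adjoin:
  "Domain (adjoin G x y) = {poly p x | p. \<forall>i. coeff p i \<in> Domain G}"
proof (intro subset_antisym subsetI)
  fix z assume "z \<in> Domain (adjoin G x y)"
  then show "z \<in> {poly p x | p. \<forall>i. coeff p i \<in> Domain G}"
    unfolding adjoin_def coeff_rel_def by blast
next
  fix z assume "z \<in> {poly p x | p. \<forall>i. coeff p i \<in> Domain G}"
  then obtain p where "z = poly p x" "\<And>i. coeff p i \<in> Domain G"
    by blast
  moreover from this(2) obtain q where "coeff_rel G p q"
    by (rule coeff_rel_exists)
  ultimately show "z \<in> Domain (adjoin G x y)"
    unfolding adjoin_def by blast
qed

lemma adjoin_superset: "G \<subseteq> adjoin G x y"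
proof
  fix u assume "u \<in> G"
  then show "u \<in> adjoin G x y"
    unfolding adjoin_def using coeff_rel_const[of "fst u" "snd u"]
    by (auto intro!: exI[of _ "[:fst u:]"] exI[of _ "[:snd u:]"])
qed

lemma adjoin_generator: "(x, y) \<in> adjoin G x y"
  unfolding adjoin_def using coeff_rel_monom[OF partial_iso_one[OF G], of 1]
  by (auto intro!: exI[of _ "monom 1 1"] simp: poly_monom)

text \<open>Closure under differences and products is inherited from polynomial arithmetic; the
  hypothesis supplies the remaining point, that zeros match zeros.\<close>

lemma partial_iso_adjoin:
  assumes "\<And>p q. coeff_rel G p q \<Longrightarrow> poly p x = 0 \<longleftrightarrow> poly q y = 0"
  shows "partial_iso (adjoin G x y)"
  unfolding partial_iso_def
proof (intro conjI allI impI)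
  show "(1, 1) \<in> adjoin G x y"
    using adjoin_superset partial_iso_one[OF G] by blast
next
  fix a a' b b' assume "(a, a') \<in> adjoin G x y" "(b, b') \<in> adjoin G x y"
  then obtain p q r s where
    pq: "coeff_rel G p q" "a = poly p x" "a' = poly q y" and
    rs: "coeff_rel G r s" "b = poly r x" "b' = poly s y"
    unfolding adjoin_def by blast
  show "(a - b, a' - b') \<in> adjoin G x y"
    unfolding adjoin_def using coeff_rel_diff[OF pq(1) rs(1)] pq rs
    by (auto intro!: exI[of _ "p - r"] exI[of _ "q - s"])
  show "(a * b, a' * b') \<in> adjoin G x y"
    unfolding adjoin_def using coeff_rel_mult[OF pq(1) rs(1)] pq rs
    by (auto intro!: exI[of _ "p * r"] exI[of _ "q * s"])
next
  fix a a' assume "(a, a') \<in> adjoin G x y"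
  then show "a = 0 \<longleftrightarrow> a' = 0"
    unfolding adjoin_def using assms by auto
qed

text \<open>On both sides only the zero polynomial vanishes, so any transcendental \<open>x\<close>
  may be sent to any transcendental \<open>y\<close>.\<close>

lemma partial_iso_adjoin_transcendental:
  assumes "\<not> algebraic_over (Domain G) x" "\<not> algebraic_over (Range G) y"
  shows "partial_iso (adjoin G x y)"
proof (rule partial_iso_adjoin)
  fix p q assume pq: "coeff_rel G p q"
  then have "coeff p i \<in> Domain G" "coeff q i \<in> Range G" for i
    unfolding coeff_rel_def by blast+
  with assms have "poly p x = 0 \<longleftrightarrow> p = 0" "poly q y = 0 \<longleftrightarrow> q = 0"
    unfolding algebraic_over_def by fastforce+
  with pq show "poly p x = 0 \<longleftrightarrow> poly q y = 0"
    using coeff_rel_eq_0_iff by simp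
qed

end

lemma Range_adjoin:
  assumes "partial_iso G"
  shows "Range (adjoin G x y) = {poly q y | q. \<forall>i. coeff q i \<in> Range G}"
  using Domain_adjoin[of "G\<inverse>" y x] assms
  by (simp add: partial_iso_converse adjoin_converse)

section \<open>Countability of adjunctions and of the set of algebraic elements\<close>

lemma countable_polys:
  assumes "countable A"
  shows "countable {p :: 'a::zero poly. \<forall>i. coeff p i \<in> A}"
proof (rule countable_subset)
  show "{p. \<forall>i. coeff p i \<in> A} \<subseteq> Poly ` lists A"
  proof
    fix p assume "p \<in> {p. \<forall>i. coeff p i \<in> A}"
    then have "coeffs p \<in> lists A"
      by (auto simp: coeffs_def)
    then show "p \<in> Poly ` lists A"
      by (metis Poly_coeffs imageI)
  qed
qed (use assms in simp)

lemma countable_adjoin: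
  assumes "partial_iso G" "countable G"
  shows "countable (adjoin G x y)"
proof (rule countable_subset)
  let ?D = "{p. \<forall>i. coeff p i \<in> fst ` G}" and ?R = "{q. \<forall>i. coeff q i \<in> snd ` G}"
  show "adjoin G x y \<subseteq> (\<lambda>(p, q). (poly p x, poly q y)) ` (?D \<times> ?R)"
    unfolding adjoin_def coeff_rel_def by force
  show "countable ((\<lambda>(p, q). (poly p x, poly q y)) ` (?D \<times> ?R))"
    using assms(2) by (intro countable_image countable_SIGMA countable_polys) auto
qed

lemma countable_algebraic_over:
  assumes "countable (D :: 'a::idom set)"
  shows "countable {x. algebraic_over D x}"
proof (rule countable_subset)
  let ?P = "{p. \<forall>i. coeff p i \<in> D} - {0}"
  show "{x. algebraic_over D x} \<subseteq> (\<Union>p\<in>?P. {x. poly p x = 0})"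
    unfolding algebraic_over_def by blast
  show "countable (\<Union>p\<in>?P. {x. poly p x = 0})"
    using countable_polys[OF assms]
    by (intro countable_UN) (auto intro: countable_finite poly_roots_finite)
qed

section \<open>Adjoining algebraic elements\<close>

text \<open>Long division of \<open>r\<close> by \<open>p\<close>, carried out in parallel for
  \<open>s\<close> and \<open>q\<close>. Instead of dividing by the leading coefficient of the
  divisor, each round multiplies the dividend by it, so all coefficients stay in the domain and
  range of \<open>G\<close>; \<open>l\<close> and \<open>l'\<close> collect these factors.\<close>

lemma partial_iso_pseudo_division:
  fixes G :: "('a::idom \<times> 'b::idom) set"
  assumes G: "partial_iso G" and p: "coeff_rel G p q" "p \<noteq> 0"
  shows "coeff_rel G r s \<Longrightarrow> \<exists>l l' u u' v v'. (l, l') \<in> G \<and> l \<noteq> 0 \<and>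
    coeff_rel G u u' \<and> coeff_rel G v v' \<and>
    smult l r = p * u + v \<and> smult l' s = q * u' + v' \<and> (v = 0 \<or> degree v < degree p)"
proof (induction "degree r" arbitrary: r s rule: less_induct)
  case less
  have z: "coeff_rel G 0 0"
    by (simp add: coeff_rel_def partial_iso_zero[OF G])
  show ?case
  proof (cases "r = 0 \<or> degree r < degree p")
    case True
    then show ?thesis
      using less.prems z partial_iso_one[OF G]
      by (intro exI[of _ 1] exI[of _ 0] exI[of _ r] exI[of _ s]) simp
  next
    case False
    define k where "k = degree r - degree p"
    define m where "m = monom (lead_coeff r) k"
    define m' where "m' = monom (lead_coeff s) k"
    have dp: "degree p = degree q" and dr: "degree r = degree s"
      using coeff_rel_degree[OF G] p(1) less.prems by blast+
    have lp: "(lead_coeff p, lead_coeff q) \<in> G" and lr: "(lead_coeff r, lead_coeff s) \<in> G"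
      using p(1) less.prems dp dr unfolding coeff_rel_def by metis+
    have m: "coeff_rel G m m'"
      unfolding m_def m'_def using coeff_rel_monom[OF G lr] .
    \<comment> \<open>The multiples are chosen so that the leading terms cancel.\<close>
    define r1 where "r1 = smult (lead_coeff p) r - p * m"
    define s1 where "s1 = smult (lead_coeff q) s - q * m'"
    have "coeff_rel G (smult (lead_coeff p) r) (smult (lead_coeff q) s)"
      using less.prems lp partial_iso_mult[OF G] by (simp add: coeff_rel_def)
    then have rel1: "coeff_rel G r1 s1"
      unfolding r1_def s1_def
      using coeff_rel_diff[OF G] coeff_rel_mult[OF G p(1) m] by blast
    \<comment> \<open>If \<open>r\<close> is constant, so is \<open>p\<close>, and the degree cannot
      drop further; then the difference vanishes altogether.\<close>
    have r1: "r1 = 0 \<or> degree r1 < degree r"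
    proof (cases "degree r = 0")
      case True
      then obtain c d where "r = [:c:]" "p = [:d:]"
        using False by (metis degree_eq_zeroE leI le_zero_eq)
      then show ?thesis
        by (simp add: r1_def m_def k_def monom_0)
    next
      case False': False
      have "degree (p * m) = degree r"
        using False p(2) by (simp add: degree_mult_eq m_def degree_monom_eq k_def)
      then have "degree r1 \<le> degree r"
        unfolding r1_def by (intro degree_diff_le) (auto simp: degree_smult_le)
      moreover have "coeff r1 (degree r) = 0"
      proof -
        have "coeff (p * m) (degree r) = lead_coeff (p * m)"
          using \<open>degree (p * m) = degree r\<close> by simp
        also have "\<dots> = lead_coeff p * lead_coeff r"
          by (simp add: lead_coeff_mult m_def degree_monom_eq False[simplified])
        finally show ?thesis
          by (simp add: r1_def)
      qed
      ultimately show ?thesis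
        using False' by (metis leading_coeff_0_iff le_neq_implies_less)
    qed
    have "\<exists>l l' u u' v v'. (l, l') \<in> G \<and> l \<noteq> 0 \<and> coeff_rel G u u' \<and> coeff_rel G v v' \<and>
      smult l r1 = p * u + v \<and> smult l' s1 = q * u' + v' \<and> (v = 0 \<or> degree v < degree p)"
    proof (cases "r1 = 0")
      case True
      then have "s1 = 0"
        using coeff_rel_eq_0_iff[OF G rel1] by simp
      with True show ?thesis
        using z partial_iso_one[OF G]
        by (intro exI[of _ 1] exI[of _ 0]) simp
    next
      case False
      with r1 show ?thesis
        using less.hyps[OF _ rel1] by blast
    qed
    then obtain l l' u u' v v' where l: "(l, l') \<in> G" "l \<noteq> 0" and
      rel: "coeff_rel G u u'" "coeff_rel G v v'" and
      eq: "smult l r1 = p * u + v" "smult l' s1 = q * u' + v'" and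
      v: "v = 0 \<or> degree v < degree p"
      by blast
    have "smult (l * lead_coeff p) r = p * (u + smult l m) + v"
      using eq(1) unfolding r1_def by (simp add: algebra_simps smult_diff_right)
    moreover have "smult (l' * lead_coeff q) s = q * (u' + smult l' m') + v'"
      using eq(2) unfolding s1_def by (simp add: algebra_simps smult_diff_right)
    moreover have "coeff_rel G (u + smult l m) (u' + smult l' m')"
      using rel(1) m l(1) partial_iso_add[OF G] partial_iso_mult[OF G]
      by (simp add: coeff_rel_def)
    moreover have "(l * lead_coeff p, l' * lead_coeff q) \<in> G" "l * lead_coeff p \<noteq> 0"
      using partial_iso_mult[OF G l(1) lp] l(2) p(2) by auto
    ultimately show ?thesis
      using rel(2) v by blast
  qed
qed

lemma degree_pos_of_root: "poly p x = 0 \<Longrightarrow> p \<noteq> 0 \<Longrightarrow> degree p > 0"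
  by (cases "degree p = 0") (auto elim!: degree_eq_zeroE)

text \<open>Take an annihilating polynomial \<open>p\<close> of \<open>x\<close> of least degree and
  let \<open>y\<close> be a root of the corresponding \<open>q\<close>. It must be shown that
  \<open>q\<close> is of least degree for \<open>y\<close> too; pseudo-division then reduces every
  relation to its remainder.\<close>

lemma partial_iso_adjoin_algebraic:
  fixes G :: "('a::field \<times> 'b::alg_closed_field) set"
  assumes G: "partial_iso G" and x: "algebraic_over (Domain G) x"
  obtains y where "partial_iso (adjoin G x y)"
proof -
  define ann where "ann p \<longleftrightarrow> p \<noteq> 0 \<and> (\<forall>i. coeff p i \<in> Domain G) \<and> poly p x = 0" for p
  obtain p where p: "ann p" and pmin: "\<And>r. ann r \<Longrightarrow> degree p \<le> degree r"
    using x ex_has_least_nat[of ann _ degree] unfolding algebraic_over_def ann_def by blast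
  obtain q where pq: "coeff_rel G p q"
    using coeff_rel_exists[OF G, of p] p unfolding ann_def by blast
  have min: "r = 0" if "coeff_rel G r s" "poly r x = 0" "degree r < degree p" for r s
    using that pmin[of r] unfolding ann_def coeff_rel_def by (meson DomainI not_le)
  have "degree p > 0"
    using p degree_pos_of_root[of p x] unfolding ann_def by blast
  then obtain y where y: "poly q y = 0"
    using alg_closed_imp_poly_has_root[of q] coeff_rel_degree[OF G pq] by auto
  have p0: "p \<noteq> 0" and px: "poly p x = 0"
    using p unfolding ann_def by auto
  \<comment> \<open>Otherwise take \<open>w\<close> of least degree among the nonzero polynomials
    below \<open>degree p\<close> whose counterpart vanishes at \<open>y\<close>. Up to a nonzero
    constant it divides \<open>p\<close>, and by minimality of \<open>p\<close> neither factor can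
    vanish at \<open>x\<close>, although the product does.\<close>
  have small: "v = 0" if v: "coeff_rel G v v'" "degree v < degree p" "poly v' y = 0" for v v'
  proof (rule ccontr)
    assume "v \<noteq> 0"
    define bad where "bad w \<longleftrightarrow> w \<noteq> 0 \<and> degree w < degree p \<and> (\<exists>w'. coeff_rel G w w' \<and> poly w' y = 0)" for w
    have "bad v"
      using v \<open>v \<noteq> 0\<close> unfolding bad_def by blast
    then obtain w where w: "bad w" and wmin: "\<And>r. bad r \<Longrightarrow> degree w \<le> degree r"
      using ex_has_least_nat[of bad v degree] by blast
    then obtain w' where w': "coeff_rel G w w'" "poly w' y = 0" "w \<noteq> 0" "degree w < degree p"
      unfolding bad_def by blast
    obtain l l' u u' t t' where l: "(l, l') \<in> G" "l \<noteq> 0" and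
      rel: "coeff_rel G u u'" "coeff_rel G t t'" and
      eq: "smult l p = w * u + t" "smult l' q = w' * u' + t'" and
      t: "t = 0 \<or> degree t < degree w"
      using partial_iso_pseudo_division[OF G w'(1,3) pq] by blast
    \<comment> \<open>The remainder \<open>t\<close> would be a smaller counterexample than
      \<open>w\<close>, hence it is zero.\<close>
    have "poly t' y = 0"
      using arg_cong[OF eq(2), of "\<lambda>p. poly p y"] y w'(2) by simp
    then have "t = 0"
      using t rel(2) wmin[of t] w'(4) unfolding bad_def by fastforce
    have wx: "poly w x \<noteq> 0"
      using min[OF w'(1)] w'(3,4) by blast
    then have ux: "poly u x = 0"
      using arg_cong[OF eq(1), of "\<lambda>p. poly p x"] px \<open>t = 0\<close> by simp
    have "u \<noteq> 0"
      using eq(1) \<open>t = 0\<close> l(2) p0 by auto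
    have "degree p = degree w + degree u"
      using arg_cong[OF eq(1), of degree] \<open>t = 0\<close> l(2) w'(3) \<open>u \<noteq> 0\<close>
      by (simp add: degree_mult_eq)
    \<comment> \<open>A nonzero constant has no root, so \<open>w\<close> is not constant and the
      cofactor \<open>u\<close> has smaller degree than \<open>p\<close>.\<close>
    moreover have "degree w > 0"
    proof (rule ccontr)
      assume "\<not> degree w > 0"
      then have "degree w' = 0"
        using coeff_rel_degree[OF G w'(1)] by simp
      then have "w' = 0"
        using w'(2) degree_pos_of_root[of w' y] by fastforce
      then show False
        using coeff_rel_eq_0_iff[OF G w'(1)] w'(3) by simp
    qed
    ultimately show False
      using min[OF rel(1) ux] \<open>u \<noteq> 0\<close> by simp
  qed
  have "partial_iso (adjoin G x y)"
  proof (rule partial_iso_adjoin[OF G])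
    fix r s assume rs: "coeff_rel G r s"
    obtain l l' u u' v v' where l: "(l, l') \<in> G" "l \<noteq> 0" and
      rel: "coeff_rel G u u'" "coeff_rel G v v'" and
      eq: "smult l r = p * u + v" "smult l' s = q * u' + v'" and
      v: "v = 0 \<or> degree v < degree p"
      using partial_iso_pseudo_division[OF G pq p0 rs] by blast
    have l': "l' \<noteq> 0"
      using partial_iso_eq_0_iff[OF G l(1)] l(2) by simp
    \<comment> \<open>Since \<open>p\<close> vanishes at \<open>x\<close>, \<open>q\<close> vanishes
      at \<open>y\<close>, and \<open>l\<close> and \<open>l'\<close> are nonzero, both sides reduce
      to the remainders \<open>v\<close> and \<open>v'\<close>.\<close>
    have "poly r x = 0 \<longleftrightarrow> poly v x = 0"
      using arg_cong[OF eq(1), of "\<lambda>p. poly p x"] px l(2) by auto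
    also have "\<dots> \<longleftrightarrow> v = 0"
      using min[OF rel(2)] v by auto
    also have "\<dots> \<longleftrightarrow> poly v' y = 0"
      using small[OF rel(2)] v coeff_rel_eq_0_iff[OF G rel(2)] by auto
    also have "\<dots> \<longleftrightarrow> poly s y = 0"
      using arg_cong[OF eq(2), of "\<lambda>p. poly p y"] y l' by auto
    finally show "poly r x = 0 \<longleftrightarrow> poly s y = 0" .
  qed
  then show thesis ..
qed

section \<open>Extension to automorphisms\<close>

text \<open>Dependent choice iterates a one-step extension; \<open>Q n\<close> records what step
  \<open>n\<close> achieves.\<close>

lemma countable_partial_iso_chain:
  assumes "partial_iso G" "countable G"
    and step: "\<And>n H. partial_iso H \<Longrightarrow> countable H \<Longrightarrow>
      \<exists>H'. partial_iso H' \<and> countable H' \<and> H \<subseteq> H' \<and> Q n H H'"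
  obtains F :: "nat \<Rightarrow> ('a::comm_ring_1 \<times> 'b::comm_ring_1) set"
  where "F 0 = G" "\<And>n. F n \<subseteq> F (Suc n)" "\<And>n. Q n (F n) (F (Suc n))"
    "partial_iso (\<Union>n. F n)" "countable (\<Union>n. F n)"
proof -
  have "\<exists>F. \<forall>n. (partial_iso (F n) \<and> countable (F n) \<and> (n = 0 \<longrightarrow> F n = G)) \<and>
      (F n \<subseteq> F (Suc n) \<and> Q n (F n) (F (Suc n)))"
    using assms(1,2) step by (intro dependent_nat_choice) auto
  then obtain F where "\<forall>n. (partial_iso (F n) \<and> countable (F n) \<and> (n = 0 \<longrightarrow> F n = G)) \<and>
      (F n \<subseteq> F (Suc n) \<and> Q n (F n) (F (Suc n)))" ..
  then have F: "\<And>n. partial_iso (F n)" "\<And>n. countable (F n)" "F 0 = G"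
    "\<And>n. F n \<subseteq> F (Suc n)" "\<And>n. Q n (F n) (F (Suc n))"
    by auto
  have "F m \<subseteq> F n \<or> F n \<subseteq> F m" for m n
    using lift_Suc_mono_le[of F, OF F(4)] by (metis nle_le)
  then have "partial_iso (\<Union>n. F n)"
    using F(1) by (intro partial_iso_Union) auto
  with F show thesis
    using that[of F] by (simp add: countable_UN)
qed

text \<open>An algebraic \<open>x\<close> is sent to a root. For a transcendental \<open>x\<close> a
  transcendental partner exists, because only countably many elements are algebraic over the
  countable range.\<close>

lemma countable_partial_iso_extend_point:
  fixes G :: "('a::field \<times> 'b::alg_closed_field) set"
  assumes unc: "uncountable (UNIV :: 'b set)" and G: "partial_iso G" "countable G"
  shows "\<exists>H. partial_iso H \<and> countable H \<and> G \<subseteq> H \<and> x \<in> Domain H"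
proof -
  obtain y where "partial_iso (adjoin G x y)"
  proof (cases "algebraic_over (Domain G) x")
    case True
    then show ?thesis
      using partial_iso_adjoin_algebraic[OF G(1)] that by blast
  next
    case False
    have "countable (Range G)"
      using G(2) by (simp add: Range_snd)
    then obtain y where "\<not> algebraic_over (Range G) y"
      using countable_algebraic_over[of "Range G"] unc
      by (metis (mono_tags, lifting) UNIV_eq_I mem_Collect_eq)
    then show ?thesis
      using partial_iso_adjoin_transcendental[OF G(1) False] that by blast
  qed
  then show ?thesis
    using countable_adjoin[OF G] adjoin_superset[OF G(1)] adjoin_generator[OF G(1)]
    by (meson DomainI)
qed

lemma countable_partial_iso_extend_Domain:
  fixes G :: "('a::field \<times> 'b::alg_closed_field) set"
  assumes unc: "uncountable (UNIV :: 'b set)" and G: "partial_iso G" "countable G"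
    and A: "countable A"
  shows "\<exists>H. partial_iso H \<and> countable H \<and> G \<subseteq> H \<and> A \<subseteq> Domain H"
\<comment> \<open>\<open>from_nat_into A\<close> enumerates \<open>A\<close> only when
  \<open>A\<close> is nonempty.\<close>
proof (cases "A = {}")
  case True
  with G show ?thesis by blast
next
  case False
  have step: "\<exists>H'. partial_iso H' \<and> countable H' \<and> H \<subseteq> H' \<and> from_nat_into A n \<in> Domain H'"
    if "partial_iso H" "countable H" for n and H :: "('a \<times> 'b) set"
    using countable_partial_iso_extend_point[OF unc that] .
  obtain F where F: "F 0 = G" "\<And>n. F n \<subseteq> F (Suc n)"
    "\<And>n. from_nat_into A n \<in> Domain (F (Suc n))"
    "partial_iso (\<Union>n. F n)" "countable (\<Union>n. F n)"
    using countable_partial_iso_chain[where Q = "\<lambda>n H H'. from_nat_into A n \<in> Domain H'", OF G step]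
    by blast
  have "A \<subseteq> Domain (\<Union>n. F n)"
  proof
    fix x assume "x \<in> A"
    then obtain n where "x = from_nat_into A n"
      using from_nat_into_surj[OF A] by metis
    with F(3)[of n] show "x \<in> Domain (\<Union>n. F n)"
      by blast
  qed
  moreover have "G \<subseteq> (\<Union>n. F n)"
    using F(1) by blast
  ultimately show ?thesis
    using F(4,5) by blast
qed

lemma countable_converse: "countable (r\<inverse>) \<longleftrightarrow> countable r"
proof -
  have "r\<inverse> = prod.swap ` r"
    by force
  then show ?thesis
    by (simp add: countable_image_inj_eq)
qed

text \<open>One round of back and forth: the domain is enlarged first, then the range, by enlarging
  the domain of the converse.\<close>

lemma countable_partial_iso_extend_Field:
  fixes G :: "('a::alg_closed_field \<times> 'a) set"
  assumes unc: "uncountable (UNIV :: 'a set)" and G: "partial_iso G" "countable G"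
  shows "\<exists>H. partial_iso H \<and> countable H \<and> G \<subseteq> H \<and> Field G \<subseteq> Domain H \<and> Field G \<subseteq> Range H"
proof -
  have cnt: "countable (Field G)"
    using G(2) by (simp add: Field_def Domain_fst Range_snd)
  obtain H where H: "partial_iso H" "countable H" "G \<subseteq> H" "Field G \<subseteq> Domain H"
    using countable_partial_iso_extend_Domain[OF unc G cnt] by blast
  obtain J where J: "partial_iso J" "countable J" "H\<inverse> \<subseteq> J" "Field G \<subseteq> Domain J"
    using countable_partial_iso_extend_Domain[OF unc _ _ cnt, of "H\<inverse>"] H(1,2)
    by (auto simp: partial_iso_converse countable_converse)
  have "partial_iso (J\<inverse>)" "countable (J\<inverse>)"
    using J(1,2) by (simp_all add: partial_iso_converse countable_converse)
  moreover have "G \<subseteq> J\<inverse>"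
    using H(3) J(3) by auto
  moreover have "Field G \<subseteq> Domain (J\<inverse>)"
    using H(4) Range_mono[OF J(3)] by simp
  moreover have "Field G \<subseteq> Range (J\<inverse>)"
    using J(4) by (simp only: Range_converse)
  ultimately show ?thesis
    by blast
qed

text \<open>Each stage places the domain and range of the previous one into both its own domain and
  its own range, so the two coincide in the union, which is then an automorphism of the subring
  \<open>Domain H\<close>.\<close>

lemma countable_partial_iso_extend_automorphism:
  fixes G :: "('a::alg_closed_field \<times> 'a) set"
  assumes unc: "uncountable (UNIV :: 'a set)" and G: "partial_iso G" "countable G"
  obtains H where "partial_iso H" "G \<subseteq> H" "Domain H = Range H"
proof -
  have step: "\<exists>H'. partial_iso H' \<and> countable H' \<and> H \<subseteq> H' \<and>
      (Field H \<subseteq> Domain H' \<and> Field H \<subseteq> Range H')"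
    if "partial_iso H" "countable H" for n :: nat and H :: "('a \<times> 'a) set"
    using countable_partial_iso_extend_Field[OF unc that] .
  obtain F where F: "F 0 = G" "\<And>n. F n \<subseteq> F (Suc n)"
    "\<And>n. Field (F n) \<subseteq> Domain (F (Suc n)) \<and> Field (F n) \<subseteq> Range (F (Suc n))"
    "partial_iso (\<Union>n. F n)"
    using countable_partial_iso_chain[OF G step] by blast
  have "G \<subseteq> (\<Union>n. F n)"
    using F(1) by blast
  moreover have "Domain (\<Union>n. F n) = Range (\<Union>n. F n)"
  proof (intro subset_antisym subsetI)
    fix x assume "x \<in> Domain (\<Union>n. F n)"
    then obtain n where "x \<in> Field (F n)"
      unfolding Field_def by blast
    then show "x \<in> Range (\<Union>n. F n)"
      using F(3)[of n] by blast
  next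
    fix x assume "x \<in> Range (\<Union>n. F n)"
    then obtain n where "x \<in> Field (F n)"
      unfolding Field_def by blast
    then show "x \<in> Domain (\<Union>n. F n)"
      using F(3)[of n] by blast
  qed
  ultimately show thesis
    using that F(4) by blast
qed

section \<open>Extension to the whole field by Zorn's lemma\<close>

text \<open>The side condition \<open>R\<close> lets one maximality argument serve twice: with equal
  domain and range, and with no restriction.\<close>

lemma maximal_partial_iso:
  fixes G :: "('a::comm_ring_1 \<times> 'b::comm_ring_1) set"
  assumes G: "partial_iso G" "R G"
    and R: "\<And>K. K \<noteq> {} \<Longrightarrow> (\<And>H. H \<in> K \<Longrightarrow> R H) \<Longrightarrow> R (\<Union>K)"
  obtains M where "partial_iso M" "G \<subseteq> M" "R M"
    "\<And>H. partial_iso H \<Longrightarrow> R H \<Longrightarrow> M \<subseteq> H \<Longrightarrow> H = M"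
proof -
  define C where "C = {H. partial_iso H \<and> G \<subseteq> H \<and> R H}"
  have "\<exists>M\<in>C. \<forall>H\<in>C. M \<subseteq> H \<longrightarrow> H = M"
  proof (rule subset_Zorn_nonempty)
    show "C \<noteq> {}"
      using G unfolding C_def by auto
    fix K assume K: "K \<noteq> {}" "subset.chain C K"
    then have "H \<in> C" if "H \<in> K" for H
      using that by (auto simp: subset_chain_def)
    then have H: "partial_iso H" "G \<subseteq> H" "R H" if "H \<in> K" for H
      using that by (simp_all add: C_def)
    have "partial_iso (\<Union>K)"
      using K H(1) by (intro partial_iso_Union) (simp_all add: subset_chain_def)
    moreover have "G \<subseteq> \<Union>K"
      using K(1) H(2) by (meson Sup_upper2 all_not_in_conv)
    moreover have "R (\<Union>K)"
      using K(1) H(3) by (rule R)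
    ultimately show "\<Union>K \<in> C"
      by (simp add: C_def)
  qed
  then obtain M where M: "M \<in> C" "\<And>H. H \<in> C \<Longrightarrow> M \<subseteq> H \<Longrightarrow> H = M"
    by blast
  show thesis
  proof (rule that[of M])
    show "partial_iso M" "G \<subseteq> M" "R M"
      using M(1) by (simp_all add: C_def)
    show "H = M" if "partial_iso H" "R H" "M \<subseteq> H" for H
      using that \<open>G \<subseteq> M\<close> M(2)[of H] by (simp add: C_def)
  qed
qed

text \<open>Equality of domain and range makes an element \<open>t\<close> transcendental over one
  transcendental over the other. Such a \<open>t\<close> can be sent to itself, which preserves the
  equality and contradicts maximality.\<close>

lemma partial_iso_extend_transcendental:
  fixes G :: "('a::idom \<times> 'a) set"
  assumes G: "partial_iso G" "Domain G = Range G"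
  obtains H where "partial_iso H" "G \<subseteq> H" "Domain H = Range H"
    "\<And>x. algebraic_over (Domain H) x"
proof -
  obtain M where M: "partial_iso M" "G \<subseteq> M" "Domain M = Range M"
    and max: "\<And>H. partial_iso H \<Longrightarrow> Domain H = Range H \<Longrightarrow> M \<subseteq> H \<Longrightarrow> H = M"
    using maximal_partial_iso[of G "\<lambda>H. Domain H = Range H"] G
    by (auto simp: Domain_Union Range_Union)
  have "algebraic_over (Domain M) t" for t
  proof (rule ccontr)
    assume t: "\<not> algebraic_over (Domain M) t"
    have "adjoin M t t = M"
    proof (rule max)
      show "partial_iso (adjoin M t t)"
        using partial_iso_adjoin_transcendental[OF M(1) t] t M(3) by simp
      show "Domain (adjoin M t t) = Range (adjoin M t t)"
        using Domain_adjoin[OF M(1)] Range_adjoin[OF M(1)] M(3) by simp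
      show "M \<subseteq> adjoin M t t"
        by (rule adjoin_superset[OF M(1)])
    qed
    then have "t \<in> Domain M"
      using adjoin_generator[OF M(1), of t t] by blast
    then have "algebraic_over (Domain M) t"
      unfolding algebraic_over_def
      using partial_iso_zero[OF M(1)] partial_iso_one[OF M(1)]
        partial_iso_diff[OF M(1) partial_iso_zero[OF M(1)]]
      by (intro exI[of _ "[:- t, 1:]"]) (auto simp: coeff_pCons Domain.simps split: nat.split)
    with t show False ..
  qed
  with M show thesis
    using that by blast
qed

lemma algebraic_over_mono: "algebraic_over D x \<Longrightarrow> D \<subseteq> E \<Longrightarrow> algebraic_over E x"
  unfolding algebraic_over_def by blast

text \<open>To a maximal extension no algebraic element can be adjoined, neither to its domain nor,
  passing to the converse, to its range; but all elements are algebraic over both.\<close>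

lemma partial_iso_extend_algebraic:
  fixes G :: "('a::alg_closed_field \<times> 'b::alg_closed_field) set"
  assumes G: "partial_iso G"
    and alg: "\<And>x. algebraic_over (Domain G) x" "\<And>y. algebraic_over (Range G) y"
  obtains H where "partial_iso H" "G \<subseteq> H" "Domain H = UNIV" "Range H = UNIV"
proof -
  obtain M where M: "partial_iso M" "G \<subseteq> M"
    and max: "\<And>H. partial_iso H \<Longrightarrow> M \<subseteq> H \<Longrightarrow> H = M"
    using maximal_partial_iso[of G "\<lambda>_. True"] G by auto
  have maxa: "(x, y) \<in> M" if "partial_iso (adjoin M x y)" for x y
    using max[OF that adjoin_superset[OF M(1)]] adjoin_generator[OF M(1), of x y] by simp
  have "x \<in> Domain M" for x
  proof -
    have "algebraic_over (Domain M) x"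
      using alg(1) M(2) by (meson Domain_mono algebraic_over_mono)
    then show ?thesis
      using partial_iso_adjoin_algebraic[OF M(1)] maxa by (metis DomainI)
  qed
  moreover have "y \<in> Range M" for y
  proof -
    have "algebraic_over (Range M) y"
      using alg(2) M(2) by (meson Range_mono algebraic_over_mono)
    then obtain x where "partial_iso (adjoin (M\<inverse>) y x)"
      using partial_iso_adjoin_algebraic[of "M\<inverse>" y] M(1) by (auto simp: partial_iso_converse)
    then show ?thesis
      using maxa[of x y] by (auto simp: adjoin_converse partial_iso_converse)
  qed
  ultimately show thesis
    using that M by blast
qed

lemma countable_partial_iso_extends_to_automorphism:
  fixes G :: "('a::alg_closed_field \<times> 'a) set"
  assumes "uncountable (UNIV :: 'a set)" "partial_iso G" "countable G"
  obtains \<phi> where "bij \<phi>" "\<phi> 1 = 1" "\<And>x y. \<phi> (x + y) = \<phi> x + \<phi> y"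
    "\<And>x y. \<phi> (x * y) = \<phi> x * \<phi> y" "\<And>x y. (x, y) \<in> G \<Longrightarrow> \<phi> x = y"
proof -
  obtain H0 where "partial_iso H0" "G \<subseteq> H0" "Domain H0 = Range H0"
    using countable_partial_iso_extend_automorphism[OF assms] .
  then obtain H1 where H1: "partial_iso H1" "G \<subseteq> H1" "Domain H1 = Range H1"
    "\<And>x. algebraic_over (Domain H1) x"
    using partial_iso_extend_transcendental by (metis subset_trans)
  obtain H where H: "partial_iso H" "G \<subseteq> H" "Domain H = UNIV" "Range H = UNIV"
    using partial_iso_extend_algebraic[OF H1(1)] H1(2-4) by (metis subset_trans)
  define \<phi> where "\<phi> x = (SOME y. (x, y) \<in> H)" for x
  have mem: "(x, \<phi> x) \<in> H" for x
    using someI_ex[of "\<lambda>y. (x, y) \<in> H"] H(3) unfolding \<phi>_def by blast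
  have eq: "\<phi> x = y" if "(x, y) \<in> H" for x y
    using partial_iso_eq_iff[OF H(1) that mem[of x]] by simp
  have "inj \<phi>"
    using partial_iso_eq_iff[OF H(1) mem mem] by (simp add: inj_def)
  moreover have "surj \<phi>"
  proof -
    have "\<exists>x. (x, y) \<in> H" for y
      using H(4) by blast
    then show ?thesis
      using eq unfolding surj_def by metis
  qed
  ultimately have "bij \<phi>"
    by (simp add: bij_def)
  then show thesis
  proof (rule that)
    show "\<phi> 1 = 1"
      by (intro eq partial_iso_one H(1))
    show "\<phi> (x + y) = \<phi> x + \<phi> y" "\<phi> (x * y) = \<phi> x * \<phi> y" for x y
      by (intro eq partial_iso_add partial_iso_mult H(1) mem)+
    show "\<phi> x = y" if "(x, y) \<in> G" for x y
      using that H(2) by (intro eq) (rule subsetD)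
  qed
qed

section \<open>Joint eigenvalues modulo an invariant subspace\<close>

text \<open>In the application \<open>T k\<close> dilates functions by \<open>k\<close>, for every
  complex \<open>k\<close>, while invariance is required only for \<open>k\<close> in a countable
  set \<open>I\<close>.\<close>

locale commuting_operators = vector_space scale
  for scale :: "'a::alg_closed_field \<Rightarrow> 'b::ab_group_add \<Rightarrow> 'b" (infixr "*s" 75) +
  fixes T :: "'i \<Rightarrow> 'b \<Rightarrow> 'b" and I :: "'i set"
  assumes T_add: "T k (u + v) = T k u + T k v"
    and T_scale: "T k (c *s v) = c *s T k v"
    and T_commute: "T k (T l v) = T l (T k v)"
begin

definition invariant :: "'b set \<Rightarrow> bool" where
  "invariant A \<longleftrightarrow> subspace A \<and> (\<forall>k\<in>I. \<forall>v\<in>A. T k v \<in> A)"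

lemma T_0: "T k 0 = 0"
  using T_add[of k 0 0] by simp

lemma T_diff: "T k (u - v) = T k u - T k v"
  using T_add[of k "u - v" v] by simp

lemma T_sum: "T k (sum f J) = (\<Sum>j\<in>J. T k (f j))"
  by (induction J rule: infinite_finite_induct) (simp_all add: T_0 T_add)

lemma invariantD:
  assumes "invariant A"
  shows invariant_0: "0 \<in> A"
    and invariant_add: "u \<in> A \<Longrightarrow> v \<in> A \<Longrightarrow> u + v \<in> A"
    and invariant_diff: "u \<in> A \<Longrightarrow> v \<in> A \<Longrightarrow> u - v \<in> A"
    and invariant_scale: "u \<in> A \<Longrightarrow> c *s u \<in> A"
    and invariant_sum: "(\<And>j. j \<in> J \<Longrightarrow> f j \<in> A) \<Longrightarrow> sum f J \<in> A"
    and invariant_T: "k \<in> I \<Longrightarrow> u \<in> A \<Longrightarrow> T k u \<in> A"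
  using assms unfolding invariant_def
  by (auto intro: subspace_0 subspace_add subspace_diff subspace_scale subspace_sum)

lemma invariant_scale_iff: "invariant A \<Longrightarrow> c *s u \<in> A \<longleftrightarrow> c = 0 \<or> u \<in> A"
  using invariant_scale[of A u c] invariant_scale[of A "c *s u" "inverse c"] invariant_0[of A]
  by (cases "c = 0") auto

lemma invariantI:
  assumes "0 \<in> A" "\<And>u v. u \<in> A \<Longrightarrow> v \<in> A \<Longrightarrow> u + v \<in> A" "\<And>c u. u \<in> A \<Longrightarrow> c *s u \<in> A"
    "\<And>k u. k \<in> I \<Longrightarrow> u \<in> A \<Longrightarrow> T k u \<in> A"
  shows "invariant A"
  using assms by (auto simp: invariant_def subspace_def)

section \<open>Polynomials in a single operator\<close>

definition poly_op :: "'i \<Rightarrow> 'a poly \<Rightarrow> 'b \<Rightarrow> 'b" where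
  "poly_op k q v = (\<Sum>i\<le>degree q. coeff q i *s (T k ^^ i) v)"

lemma poly_op_bound:
  assumes "degree q \<le> n"
  shows "poly_op k q v = (\<Sum>i\<le>n. coeff q i *s (T k ^^ i) v)"
  unfolding poly_op_def using assms
  by (intro sum.mono_neutral_left) (auto simp: coeff_eq_0)

lemma poly_op_add: "poly_op k (p + q) v = poly_op k p v + poly_op k q v"
proof -
  let ?n = "max (degree p) (degree q)"
  have "poly_op k (p + q) v = (\<Sum>i\<le>?n. coeff (p + q) i *s (T k ^^ i) v)"
    by (intro poly_op_bound degree_add_le_max)
  also have "\<dots> = poly_op k p v + poly_op k q v"
    by (simp add: poly_op_bound[of p ?n] poly_op_bound[of q ?n] scale_left_distrib sum.distrib)
  finally show ?thesis .
qed

lemma poly_op_smult: "poly_op k (smult c q) v = c *s poly_op k q v"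
proof -
  have "poly_op k (smult c q) v = (\<Sum>i\<le>degree q. (c * coeff q i) *s (T k ^^ i) v)"
    using poly_op_bound[OF degree_smult_le] by simp
  also have "\<dots> = c *s poly_op k q v"
    unfolding poly_op_def scale_sum_right scale_scale ..
  finally show ?thesis .
qed

lemma poly_op_0: "poly_op k 0 v = 0"
  by (simp add: poly_op_def)

lemma poly_op_sum: "poly_op k (sum f J) v = (\<Sum>j\<in>J. poly_op k (f j) v)"
  by (induction J rule: infinite_finite_induct) (simp_all add: poly_op_0 poly_op_add)

lemma T_funpow_add: "(T k ^^ i) (u + v) = (T k ^^ i) u + (T k ^^ i) v"
  by (induction i) (simp_all add: T_add)

lemma T_funpow_scale: "(T k ^^ i) (c *s v) = c *s (T k ^^ i) v"
  by (induction i) (simp_all add: T_scale)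

lemma poly_op_add_right: "poly_op k q (u + v) = poly_op k q u + poly_op k q v"
  by (simp add: poly_op_def T_funpow_add scale_right_distrib sum.distrib)

lemma poly_op_scale_right: "poly_op k q (c *s v) = c *s poly_op k q v"
  by (simp add: poly_op_def T_funpow_scale scale_sum_right mult.commute)

lemma poly_op_0_right: "poly_op k q 0 = 0"
  using poly_op_add_right[of k q 0 0] by simp

lemma poly_op_diff_right: "poly_op k q (u - v) = poly_op k q u - poly_op k q v"
  using poly_op_add_right[of k q "u - v" v] by simp

lemma poly_op_sum_right: "poly_op k q (sum f J) = (\<Sum>j\<in>J. poly_op k q (f j))"
  by (induction J rule: infinite_finite_induct) (simp_all add: poly_op_0_right poly_op_add_right)

lemma poly_op_pCons_0: "poly_op k (pCons 0 q) v = T k (poly_op k q v)"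
proof -
  have "poly_op k (pCons 0 q) v = (\<Sum>i\<le>Suc (degree q). coeff (pCons 0 q) i *s (T k ^^ i) v)"
    by (intro poly_op_bound degree_pCons_le)
  also have "\<dots> = T k (poly_op k q v)"
    by (simp add: sum.atMost_Suc_shift T_sum T_scale poly_op_def del: sum.atMost_Suc)
  finally show ?thesis .
qed

lemma poly_op_linear_factor:
  "poly_op k ([:- w, 1:] * q) v = T k (poly_op k q v) - w *s poly_op k q v"
proof -
  have "[:- w, 1:] * q = pCons 0 q + smult (- w) q"
    by simp
  then show ?thesis
    by (simp only: poly_op_add poly_op_pCons_0 poly_op_smult) simp
qed

lemma poly_op_T: "poly_op k q (T k v) = T k (poly_op k q v)"
  by (simp add: poly_op_def T_sum T_scale funpow_swap1)

lemma invariant_poly_op: "invariant A \<Longrightarrow> k \<in> I \<Longrightarrow> v \<in> A \<Longrightarrow> poly_op k q v \<in> A"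
proof -
  assume A: "invariant A" "k \<in> I" "v \<in> A"
  have "(T k ^^ i) v \<in> A" for i
    using A by (induction i) (auto intro: invariant_T)
  then show ?thesis
    unfolding poly_op_def by (intro invariant_sum invariant_scale A)
qed

section \<open>Eigenvalues modulo a maximal invariant subspace\<close>

text \<open>Zorn's lemma above \<open>{0}\<close>. Maximality means that every nonzero invariant
  subspace of \<open>N\<close> modulo \<open>P\<close> contains the class of \<open>f\<close>, which
  substitutes for simplicity of the quotient.\<close>

lemma maximal_invariant_avoiding:
  assumes N: "invariant N" and "f \<noteq> 0"
  obtains P where "invariant P" "P \<subseteq> N" "f \<notin> P"
    "\<And>Q. invariant Q \<Longrightarrow> P \<subseteq> Q \<Longrightarrow> Q \<subseteq> N \<Longrightarrow> f \<notin> Q \<Longrightarrow> Q = P"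
proof -
  define C where "C = {Q. invariant Q \<and> Q \<subseteq> N \<and> f \<notin> Q}"
  have "\<exists>M\<in>C. \<forall>Q\<in>C. M \<subseteq> Q \<longrightarrow> Q = M"
  proof (rule subset_Zorn_nonempty)
    have "invariant {0}"
      by (rule invariantI) (auto simp: T_0)
    then show "C \<noteq> {}"
      using invariant_0[OF N] \<open>f \<noteq> 0\<close> unfolding C_def by blast
  next
    fix K assume K: "K \<noteq> {}" "subset.chain C K"
    then have inv: "\<And>Q. Q \<in> K \<Longrightarrow> invariant Q"
      unfolding C_def subset_chain_def by blast
    have "invariant (\<Union>K)"
    proof (rule invariantI)
      show "0 \<in> \<Union>K"
        using K(1) inv invariant_0 by blast
      fix u v assume "u \<in> \<Union>K" "v \<in> \<Union>K"
      then obtain Q where "Q \<in> K" "u \<in> Q" "v \<in> Q"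
        using K(2) unfolding subset_chain_def by blast
      then show "u + v \<in> \<Union>K"
        using inv invariant_add by blast
    qed (use inv invariant_scale invariant_T in blast)+
    then show "\<Union>K \<in> C"
      using K(2) unfolding C_def subset_chain_def by blast
  qed
  then obtain M where M: "M \<in> C" "\<And>Q. Q \<in> C \<Longrightarrow> M \<subseteq> Q \<Longrightarrow> Q = M"
    by blast
  show thesis
  proof (rule that[of M])
    show "invariant M" "M \<subseteq> N" "f \<notin> M"
      using M(1) by (simp_all add: C_def)
  qed (use M(2) in \<open>simp add: C_def\<close>)
qed

text \<open>A form of Schur's lemma in countable dimension over an uncountable algebraically closed
  field. If \<open>T k\<close> had no eigenvalue at \<open>f\<close>, every \<open>T k - w\<close>
  would be injective on \<open>N\<close> modulo \<open>P\<close> with \<open>f\<close> in its image;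
  a linear relation among the preimages of \<open>f\<close> then yields a contradiction.\<close>

lemma eigenvalue_mod_maximal_invariant:
  assumes unc: "uncountable (UNIV :: 'a set)"
    and N: "invariant N" "countable B" "N \<subseteq> span B"
    and P: "invariant P" "P \<subseteq> N" "f \<in> N" "f \<notin> P"
    and max: "\<And>Q. invariant Q \<Longrightarrow> P \<subseteq> Q \<Longrightarrow> Q \<subseteq> N \<Longrightarrow> f \<notin> Q \<Longrightarrow> Q = P"
    and k: "k \<in> I"
  shows "\<exists>w. T k f - w *s f \<in> P"
proof (rule ccontr)
  assume "\<nexists>w. T k f - w *s f \<in> P"
  then have no: "\<And>w. T k f - w *s f \<notin> P"
    by blast
  define D where "D w v = T k v - w *s v" for w v
  have D_0: "D w 0 = 0" for w
    by (simp add: D_def T_0)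
  have D_add: "D w (u + v) = D w u + D w v" for w u v
    by (simp add: D_def T_add scale_right_distrib)
  have D_scale: "D w (c *s v) = c *s D w v" for w c v
    by (simp add: D_def T_scale scale_right_diff_distrib scale_left_commute)
  have D_T: "D w (T l v) = T l (D w v)" for w l v
    by (simp add: D_def T_diff T_scale T_commute)
  have D_mem: "D w v \<in> A" if "invariant A" "v \<in> A" for w v A
    unfolding D_def using that by (intro invariant_diff invariant_T invariant_scale k)
  \<comment> \<open>The kernel of \<open>D w\<close> modulo \<open>P\<close> is invariant, since the
    operators commute, and omits \<open>f\<close>; by maximality it is \<open>P\<close>.\<close>
  have D_inj: "h \<in> P" if "h \<in> N" "D w h \<in> P" for h w
  proof -
    have "{h \<in> N. D w h \<in> P} = P"
    proof (rule max)
      show "invariant {h \<in> N. D w h \<in> P}"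
        using N(1) P(1)
        by (intro invariantI)
          (auto simp: D_0 D_add D_scale D_T invariant_0 invariant_add invariant_scale invariant_T)
      show "P \<subseteq> {h \<in> N. D w h \<in> P}"
        using P(1,2) D_mem by blast
      show "f \<notin> {h \<in> N. D w h \<in> P}"
        using no[of w] by (simp add: D_def)
    qed blast
    with that show ?thesis by blast
  qed
  \<comment> \<open>The space \<open>P + D w N\<close> is invariant. If it omitted \<open>f\<close>,
    it would be \<open>P\<close>, which does not contain \<open>D w f\<close>.\<close>
  have "\<exists>g\<in>N. f - D w g \<in> P" for w
  proof -
    let ?Q = "{u + D w g | u g. u \<in> P \<and> g \<in> N}"
    have "f \<in> ?Q"
    proof (rule ccontr)
      assume "f \<notin> ?Q"
      have "?Q = P"
      proof (rule max)
        show "invariant ?Q"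
        proof (rule invariantI)
          show "0 \<in> ?Q"
            using invariant_0[OF P(1)] invariant_0[OF N(1)] D_0 by force
        next
          fix u v assume "u \<in> ?Q" "v \<in> ?Q"
          then obtain a g b h where "u = a + D w g" "v = b + D w h" "a \<in> P" "b \<in> P" "g \<in> N" "h \<in> N"
            by blast
          moreover from this have "u + v = (a + b) + D w (g + h)"
            by (simp add: D_add)
          ultimately show "u + v \<in> ?Q"
            using invariant_add[OF P(1)] invariant_add[OF N(1)] by blast
        next
          fix c u assume "u \<in> ?Q"
          then obtain a g where "u = a + D w g" "a \<in> P" "g \<in> N"
            by blast
          moreover from this have "c *s u = c *s a + D w (c *s g)"
            by (simp add: D_scale scale_right_distrib)
          ultimately show "c *s u \<in> ?Q"
            using invariant_scale[OF P(1)] invariant_scale[OF N(1)] by blast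
        next
          fix l u assume "l \<in> I" "u \<in> ?Q"
          then obtain a g where "u = a + D w g" "a \<in> P" "g \<in> N"
            by blast
          moreover from this have "T l u = T l a + D w (T l g)"
            by (simp add: D_T T_add)
          ultimately show "T l u \<in> ?Q"
            using invariant_T[OF P(1) \<open>l \<in> I\<close>] invariant_T[OF N(1) \<open>l \<in> I\<close>] by blast
        qed
        show "P \<subseteq> ?Q"
          using invariant_0[OF N(1)] D_0 by force
        show "?Q \<subseteq> N"
          using invariant_add[OF N(1)] D_mem[OF N(1)] P(2) by blast
      qed (rule \<open>f \<notin> ?Q\<close>)
      moreover have "D w f \<in> ?Q"
        using invariant_0[OF P(1)] P(3) by force
      ultimately show False
        using no[of w] by (simp add: D_def)
    qed
    then obtain u g where "f = u + D w g" "u \<in> P" "g \<in> N"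
      by blast
    then show ?thesis
      by (intro bexI[of _ g]) simp_all
  qed
  then obtain g where gN: "\<And>w. g w \<in> N" and g: "\<And>w. f - D w (g w) \<in> P"
    by metis
  \<comment> \<open>A common value for \<open>w\<close> and \<open>w'\<close> would lie in
    \<open>P\<close>, forcing \<open>f\<close> into \<open>P\<close>. Injectivity lets linear
    relations among the values of \<open>g\<close> be indexed by the scalars
    \<open>w\<close>.\<close>
  have "inj g"
  proof (rule injI, rule ccontr)
    fix w w' assume eq: "g w = g w'" and "w \<noteq> w'"
    have "(f - D w (g w)) - (f - D w' (g w')) = (w - w') *s g w"
      by (simp add: D_def eq scale_left_diff_distrib)
    then have "(w - w') *s g w \<in> P"
      using invariant_diff[OF P(1) g g] by metis
    then have "g w \<in> P"
      using \<open>w \<noteq> w'\<close> invariant_scale_iff[OF P(1)] by simp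
    then show False
      using invariant_add[OF P(1) g[of w] D_mem[OF P(1), of "g w" w]] P(4) by simp
  qed
  \<comment> \<open>The uncountably many scalars are distributed over the countably many finite
    subsets of \<open>B\<close>, so some finite-dimensional span receives infinitely many values of
    \<open>g\<close>, and these are dependent.\<close>
  obtain S where S: "finite S" "infinite {w. g w \<in> span S}"
  proof -
    have "UNIV = (\<Union>S\<in>{S. finite S \<and> S \<subseteq> B}. {w. g w \<in> span S})"
    proof (intro subset_antisym subsetI)
      fix w :: 'a
      have "g w \<in> span B"
        using gN N(3) by blast
      then obtain S r where "finite S" "S \<subseteq> B" "g w = (\<Sum>v\<in>S. r v *s v)"
        unfolding span_explicit by blast
      moreover from this have "g w \<in> span S"
        by (auto intro: span_sum span_scale span_base)
      ultimately show "w \<in> (\<Union>S\<in>{S. finite S \<and> S \<subseteq> B}. {w. g w \<in> span S})"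
        by blast
    qed simp
    then have "\<not> (\<forall>S. finite S \<longrightarrow> finite {w. g w \<in> span S})"
      using unc countable_Collect_finite_subset[OF N(2)]
      by (metis (no_types, lifting) countable_UN countable_finite mem_Collect_eq)
    then show thesis
      using that by blast
  qed
  define W where "W = {w. g w \<in> span S}"
  have "dependent (g ` W)"
    using independent_span_bound[OF S(1), of "g ` W"] S(2) \<open>inj g\<close>
    by (auto simp: W_def finite_image_iff inj_on_subset)
  then obtain J' u v where J': "finite J'" "J' \<subseteq> g ` W" "(\<Sum>v\<in>J'. u v *s v) = 0" "v \<in> J'" "u v \<noteq> 0"
    unfolding dependent_explicit by blast
  define J where "J = g -` J'"
  have gJ: "g ` J = J'"
    using J'(2) unfolding J_def by auto
  define c where "c w = u (g w)" for w
  have fin: "finite J"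
    unfolding J_def using J'(1) \<open>inj g\<close> by (rule finite_vimageI)
  have sum0: "(\<Sum>w\<in>J. c w *s g w) = 0"
    using J'(3) sum.reindex[OF inj_on_subset[OF \<open>inj g\<close> subset_UNIV], of "\<lambda>v. u v *s v" J]
    by (simp add: gJ c_def)
  obtain w0 where w0: "w0 \<in> J" "c w0 \<noteq> 0"
    using J'(4,5) gJ unfolding c_def by auto
  \<comment> \<open>Clearing denominators in the relation among the resolvents: \<open>r\<close> is
    the numerator of the sum of the \<open>c w / (X - w)\<close>. As in Lagrange interpolation, only
    the term of \<open>w0\<close> survives at \<open>w0\<close>, so \<open>r\<close> is
    nonzero.\<close>
  define q where "q w = (\<Prod>l\<in>J - {w}. [:- l, 1:])" for w
  define r where "r = (\<Sum>w\<in>J. smult (c w) (q w))"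
  have factor: "(\<Prod>l\<in>J. [:- l, 1:]) = [:- w, 1:] * q w" if "w \<in> J" for w
    unfolding q_def using fin that by (simp add: prod.remove)
  have "poly r w0 \<noteq> 0"
  proof -
    have "poly (q w) w0 = 0" if "w \<in> J - {w0}" for w
      unfolding q_def poly_prod using that fin w0(1) by (intro prod_zero) auto
    then have "poly r w0 = c w0 * poly (q w0) w0"
      unfolding r_def poly_sum using fin w0(1) by (simp add: sum.remove)
    moreover have "poly (q w0) w0 \<noteq> 0"
      unfolding q_def poly_prod using fin by simp
    ultimately show ?thesis
      using w0(2) by simp
  qed
  then have "r \<noteq> 0"
    by auto
  have "poly_op k r f \<in> P"
  proof -
    have "poly_op k (q w) f - poly_op k (\<Prod>l\<in>J. [:- l, 1:]) (g w) \<in> P" if "w \<in> J" for w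
    proof -
      \<comment> \<open>Splitting off the factor belonging to \<open>w\<close> turns
        \<open>g w\<close> into \<open>D w (g w)\<close>, which is \<open>f\<close> modulo
        \<open>P\<close>.\<close>
      have "poly_op k (\<Prod>l\<in>J. [:- l, 1:]) (g w) = poly_op k (q w) (D w (g w))"
        using that
        by (simp only: factor poly_op_linear_factor D_def poly_op_diff_right poly_op_T poly_op_scale_right)
      then show ?thesis
        using invariant_poly_op[OF P(1) k g] by (simp add: poly_op_diff_right)
    qed
    then have "(\<Sum>w\<in>J. c w *s (poly_op k (q w) f - poly_op k (\<Prod>l\<in>J. [:- l, 1:]) (g w))) \<in> P"
      by (intro invariant_sum invariant_scale P(1))
    also have "(\<Sum>w\<in>J. c w *s (poly_op k (q w) f - poly_op k (\<Prod>l\<in>J. [:- l, 1:]) (g w))) =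
        poly_op k r f - poly_op k (\<Prod>l\<in>J. [:- l, 1:]) (\<Sum>w\<in>J. c w *s g w)"
      by (simp only: r_def poly_op_sum poly_op_smult poly_op_sum_right poly_op_scale_right
          scale_right_diff_distrib sum_subtractf)
    finally show ?thesis
      by (simp add: sum0 poly_op_0_right)
  qed
  \<comment> \<open>Algebraic closedness splits \<open>p\<close> into linear factors, each of which
    is cancelled modulo \<open>P\<close> by \<open>D_inj\<close>.\<close>
  moreover have "h \<in> P" if "h \<in> N" "p \<noteq> 0" "poly_op k p h \<in> P" for h p
    using that(2,3)
  proof (induction "degree p" arbitrary: p)
    case 0
    then obtain a where "p = [:a:]" "a \<noteq> 0"
      by (metis degree_eq_zeroE pCons_0_0)
    with 0 show ?case
      by (simp add: poly_op_def invariant_scale_iff[OF P(1)])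
  next
    case (Suc n)
    then obtain z where "poly p z = 0"
      using alg_closed_imp_poly_has_root[of p] by auto
    then obtain s where s: "p = [:- z, 1:] * s"
      by (auto simp: poly_eq_0_iff_dvd elim: dvdE)
    then have "s \<noteq> 0"
      using Suc.prems(1) by auto
    then have "n = degree s"
      using Suc.hyps(2) unfolding s by (simp add: degree_mult_eq del: mult_pCons_left)
    moreover have "poly_op k s h \<in> P"
      using Suc.prems(2) unfolding s poly_op_linear_factor
      by (intro D_inj[where w = z, OF invariant_poly_op[OF N(1) k that(1)]]) (simp add: D_def)
    ultimately show ?case
      using Suc.hyps(1) \<open>s \<noteq> 0\<close> by blast
  qed
  ultimately show False
    using P(3,4) \<open>r \<noteq> 0\<close> by blast
qed

text \<open>\<open>P\<close> is chosen before \<open>k\<close>, so one subspace serves all operators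
  simultaneously.\<close>

theorem joint_eigenvalues_mod_invariant:
  assumes "uncountable (UNIV :: 'a set)" "invariant N" "countable B" "N \<subseteq> span B" "f \<in> N" "f \<noteq> 0"
  obtains P \<phi> where "invariant P" "f \<notin> P" "\<And>k. k \<in> I \<Longrightarrow> T k f - \<phi> k *s f \<in> P"
proof -
  obtain P where P: "invariant P" "P \<subseteq> N" "f \<notin> P"
    "\<And>Q. invariant Q \<Longrightarrow> P \<subseteq> Q \<Longrightarrow> Q \<subseteq> N \<Longrightarrow> f \<notin> Q \<Longrightarrow> Q = P"
    using maximal_invariant_avoiding[OF assms(2,6)] by blast
  have "\<forall>k\<in>I. \<exists>w. T k f - w *s f \<in> P"
    using eigenvalue_mod_maximal_invariant[OF assms(1-4) P(1,2) assms(5) P(3,4)] by blast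
  then show thesis
    using that P(1,3) by metis
qed

end

section \<open>Solutions of the functional equation\<close>

text \<open>Close \<open>insert 1 S\<close> under the field operations countably often. The stages
  increase, so any two elements of the union lie in a common stage.\<close>

lemma countable_subfield_superset:
  fixes S :: "'a::field set"
  assumes "countable S"
  obtains K where "countable K" "S \<subseteq> K" "1 \<in> K" "\<And>x y. x \<in> K \<Longrightarrow> y \<in> K \<Longrightarrow> x + y \<in> K"
    "\<And>x y. x \<in> K \<Longrightarrow> y \<in> K \<Longrightarrow> x - y \<in> K" "\<And>x y. x \<in> K \<Longrightarrow> y \<in> K \<Longrightarrow> x * y \<in> K"
    "\<And>x. x \<in> K \<Longrightarrow> inverse x \<in> K"
proof -
  define F where "F A = A \<union> (\<lambda>(x, y). x + y) ` (A \<times> A) \<union> (\<lambda>(x, y). x - y) ` (A \<times> A) \<union>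
    (\<lambda>(x, y). x * y) ` (A \<times> A) \<union> inverse ` A" for A :: "'a set"
  define E where "E n = (F ^^ n) (insert 1 S)" for n
  have E_Suc: "E (Suc n) = F (E n)" for n
    by (simp add: E_def)
  have "countable (E n)" for n
    by (induction n) (use assms in \<open>simp_all add: E_def F_def\<close>)
  moreover have mono: "E m \<subseteq> E n" if "m \<le> n" for m n
    by (rule lift_Suc_mono_le[OF _ that]) (auto simp: E_Suc F_def)
  have two: "\<exists>n. x \<in> E n \<and> y \<in> E n" if xy: "x \<in> (\<Union>n. E n)" "y \<in> (\<Union>n. E n)" for x y
  proof -
    obtain i j where "x \<in> E i" "y \<in> E j"
      using xy by blast
    then have "x \<in> E (max i j) \<and> y \<in> E (max i j)"
      using mono[of i "max i j"] mono[of j "max i j"] by auto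
    then show ?thesis ..
  qed
  have base: "insert 1 S \<subseteq> (\<Union>n. E n)"
    using UN_upper[of 0 UNIV E] by (simp add: E_def)
  have step: "z \<in> (\<Union>n. E n)" if "z \<in> F (E n)" for z n
    using that E_Suc by blast
  show thesis
  proof (rule that[of "\<Union>n. E n"])
    show "x + y \<in> (\<Union>n. E n)" "x - y \<in> (\<Union>n. E n)" "x * y \<in> (\<Union>n. E n)"
      if xy: "x \<in> (\<Union>n. E n)" "y \<in> (\<Union>n. E n)" for x y
    proof -
      obtain n where "x \<in> E n" "y \<in> E n"
        using two[OF xy] by blast
      then show "x + y \<in> (\<Union>n. E n)" "x - y \<in> (\<Union>n. E n)" "x * y \<in> (\<Union>n. E n)"
        by (intro step[of _ n]; force simp: F_def)+
    qed
    show "inverse x \<in> (\<Union>n. E n)" if x: "x \<in> (\<Union>n. E n)" for x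
    proof -
      obtain n where "x \<in> E n"
        using x by blast
      then show ?thesis
        by (intro step[of _ n]) (simp add: F_def)
    qed
  qed (use base calculation in auto)
qed

text \<open>
  Each defining relation of \<open>f\<close> says that an operator \<open>\<Sum>i. a i * T (\<alpha> i)\<close> annihilates \<open>f\<close>,
  where \<open>T k g = (\<lambda>x. g (k * x))\<close>; modulo \<open>P\<close> the operator \<open>T k\<close> multiplies \<open>f\<close> by \<open>\<phi> k\<close>.
\<close>

lemma additive_dilation_character:
  fixes f :: "complex \<Rightarrow> complex"
  assumes f: "additive f" "f \<noteq> (\<lambda>_. 0)"
    and K: "countable K" "1 \<in> K" "\<And>x y. x \<in> K \<Longrightarrow> y \<in> K \<Longrightarrow> x + y \<in> K"
      "\<And>x y. x \<in> K \<Longrightarrow> y \<in> K \<Longrightarrow> x * y \<in> K"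
  obtains \<phi> where "\<phi> 1 = 1" "\<And>x y. x \<in> K \<Longrightarrow> y \<in> K \<Longrightarrow> \<phi> (x + y) = \<phi> x + \<phi> y"
    "\<And>x y. x \<in> K \<Longrightarrow> y \<in> K \<Longrightarrow> \<phi> (x * y) = \<phi> x * \<phi> y"
    "\<And>J (a :: nat \<Rightarrow> complex) \<gamma>. \<lbrakk>\<And>i. i \<in> J \<Longrightarrow> \<gamma> i \<in> K; \<And>x. (\<Sum>i\<in>J. a i * f (\<gamma> i * x)) = 0\<rbrakk> \<Longrightarrow>
      (\<Sum>i\<in>J. a i * \<phi> (\<gamma> i)) = 0"
proof -
  define T :: "complex \<Rightarrow> (complex \<Rightarrow> complex) \<Rightarrow> complex \<Rightarrow> complex" where
    "T k g = (\<lambda>x. g (k * x))" for k g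
  interpret commuting_operators "\<lambda>c g x. c * g x" T K
    by unfold_locales (auto simp: T_def fun_eq_iff algebra_simps)
  define B where "B = (\<lambda>k. T k f) ` K"
  have "T 1 f = f"
    by (simp add: T_def)
  then have f_B: "f \<in> span B"
    using K(2) unfolding B_def by (metis imageI span_base)
  have "invariant (span B)"
    unfolding invariant_def
  proof (intro conjI ballI)
    show "subspace (span B)"
      by (rule subspace_span)
    fix k v assume k: "k \<in> K" and v: "v \<in> span B"
    show "T k v \<in> span B"
      using v
    proof (induction rule: span_induct_alt)
      case base
      then show ?case
        unfolding T_0 by (rule span_zero)
    next
      case (step c b v)
      then obtain l where l: "b = T l f" "l \<in> K"
        by (auto simp: B_def)
      \<comment> \<open>A dilate of a dilate of \<open>f\<close> is again a dilate of
        \<open>f\<close>, which makes the span invariant.\<close>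
      then have "T k b = T (l * k) f"
        by (simp add: T_def mult.assoc)
      then have "T k b \<in> span B"
        using K(4)[OF l(2) k] by (auto simp: B_def intro: span_base)
      then show ?case
        unfolding T_add T_scale by (intro span_add span_scale step)
    qed
  qed
  moreover have "countable B" "f \<noteq> 0"
    using K(1) f(2) by (simp_all add: B_def zero_fun_def)
  ultimately obtain P \<phi> where P: "invariant P" "f \<notin> P"
    and \<phi>: "\<And>k. k \<in> K \<Longrightarrow> T k f - (\<lambda>x. \<phi> k * f x) \<in> P"
    using joint_eigenvalues_mod_invariant[OF uncountable_UNIV_complex _ _ order_refl f_B] by blast
  \<comment> \<open>As \<open>f\<close> is not in \<open>P\<close>, a scalar multiple of
    \<open>f\<close> determines its scalar modulo \<open>P\<close>. The identities for \<phi> are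
    therefore proved by comparing multiples of \<open>f\<close>.\<close>
  have unique: "c = d" if "(\<lambda>x. c * f x) - (\<lambda>x. d * f x) \<in> P" for c d
  proof -
    have "(\<lambda>x. c * f x) - (\<lambda>x. d * f x) = (\<lambda>x. (c - d) * f x)"
      by (simp add: fun_eq_iff algebra_simps)
    then show ?thesis
      using that invariant_scale_iff[OF P(1), of "c - d" f] P(2) by simp
  qed
  have add: "\<phi> (x + y) = \<phi> x + \<phi> y" if "x \<in> K" "y \<in> K" for x y
  proof (rule unique)
    \<comment> \<open>By additivity of \<open>f\<close>, \<open>T (x + y) f\<close> is the sum of
      \<open>T x f\<close> and \<open>T y f\<close>, so only the three error terms in
      \<open>P\<close> remain.\<close>
    have "(\<lambda>u. \<phi> (x + y) * f u) - (\<lambda>u. (\<phi> x + \<phi> y) * f u) =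
        ((T x f - (\<lambda>u. \<phi> x * f u)) + (T y f - (\<lambda>u. \<phi> y * f u))) - (T (x + y) f - (\<lambda>u. \<phi> (x + y) * f u))"
      by (simp add: fun_eq_iff T_def algebra_simps additive.add[OF f(1)])
    also have "\<dots> \<in> P"
      by (intro invariant_diff[OF P(1)] invariant_add[OF P(1)] \<phi> that K(3))
    finally show "(\<lambda>u. \<phi> (x + y) * f u) - (\<lambda>u. (\<phi> x + \<phi> y) * f u) \<in> P" .
  qed
  have mult: "\<phi> (x * y) = \<phi> x * \<phi> y" if "x \<in> K" "y \<in> K" for x y
  proof (rule unique)
    have T_xy: "f (y * (x * u)) = f (x * y * u)" for u
      by (metis mult.assoc mult.commute)
    \<comment> \<open>\<open>T (x * y) f\<close> equals \<open>T x (T y f)\<close>. Modulo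
      \<open>P\<close> this is \<phi> \<open>y\<close> times \<open>T x f\<close>, by invariance of
      \<open>P\<close> under \<open>T x\<close>, and then \<phi> \<open>x\<close> times \<phi>
      \<open>y\<close> times \<open>f\<close>.\<close>
    have "(\<lambda>u. \<phi> (x * y) * f u) - (\<lambda>u. (\<phi> x * \<phi> y) * f u) =
        (T x (T y f - (\<lambda>u. \<phi> y * f u)) + (\<lambda>u. \<phi> y * (T x f - (\<lambda>u. \<phi> x * f u)) u)) -
        (T (x * y) f - (\<lambda>u. \<phi> (x * y) * f u))"
      by (rule ext) (simp add: T_def right_diff_distrib T_xy)
    also have "\<dots> \<in> P"
      using that
      by (intro invariant_diff[OF P(1)] invariant_add[OF P(1)] invariant_T[OF P(1)]
          invariant_scale[OF P(1)] \<phi> K(4))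
    finally show "(\<lambda>u. \<phi> (x * y) * f u) - (\<lambda>u. (\<phi> x * \<phi> y) * f u) \<in> P" .
  qed
  have one: "\<phi> 1 = 1"
  proof (rule unique[symmetric])
    show "(\<lambda>u. 1 * f u) - (\<lambda>u. \<phi> 1 * f u) \<in> P"
      using \<phi>[OF K(2)] by (simp add: T_def)
  qed
  have rel: "(\<Sum>i\<in>J. a i * \<phi> (\<gamma> i)) = 0"
    if \<gamma>: "\<And>i. i \<in> J \<Longrightarrow> \<gamma> i \<in> K" and 0: "\<And>x. (\<Sum>i\<in>J. a i * f (\<gamma> i * x)) = 0"
    for J :: "nat set" and a \<gamma>
  proof (rule unique[symmetric])
    have sum_apply: "sum g J x = (\<Sum>i\<in>J. g i x)" for g :: "nat \<Rightarrow> complex \<Rightarrow> complex" and x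
      by (induction J rule: infinite_finite_induct) simp_all
    have "(\<lambda>u. 0 * f u) - (\<lambda>u. (\<Sum>i\<in>J. a i * \<phi> (\<gamma> i)) * f u) =
        (\<Sum>i\<in>J. (\<lambda>u. a i * (T (\<gamma> i) f - (\<lambda>u. \<phi> (\<gamma> i) * f u)) u))"
      using 0 by (simp add: fun_eq_iff sum_apply T_def right_diff_distrib sum_subtractf
          sum_distrib_right mult.assoc)
    also have "\<dots> \<in> P"
      by (intro invariant_sum[OF P(1)] invariant_scale[OF P(1)] \<phi> \<gamma>)
    finally show "(\<lambda>u. 0 * f u) - (\<lambda>u. (\<Sum>i\<in>J. a i * \<phi> (\<gamma> i)) * f u) \<in> P" .
  qed
  show thesis
    using that one add mult rel by blast
qed

text \<open>The two coefficient sums involve only values on a countable field containing the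
  coefficients, so they survive the extension of the character from that field to an
  automorphism.\<close>

lemma automorphism_from_homogeneous_solution:
  fixes f :: "complex \<Rightarrow> complex" and a :: "nat \<Rightarrow> complex"
  assumes f: "additive f" "f \<noteq> (\<lambda>_. 0)" "solves_on UNIV n a \<alpha> \<beta> f 0"
  obtains \<phi> where "bij \<phi>" "\<phi> 1 = 1" "\<And>x y. \<phi> (x + y) = \<phi> x + \<phi> y"
    "\<And>x y. \<phi> (x * y) = \<phi> x * \<phi> y"
    "(\<Sum>i=1..n. a i * \<phi> (\<alpha> i)) = 0" "(\<Sum>i=1..n. a i * \<phi> (\<beta> i)) = 0"
proof -
  have "countable (\<alpha> ` {1..n} \<union> \<beta> ` {1..n})"
    by simp
  then obtain K where K: "countable K" "\<alpha> ` {1..n} \<union> \<beta> ` {1..n} \<subseteq> K" "1 \<in> K"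
    "\<And>x y. x \<in> K \<Longrightarrow> y \<in> K \<Longrightarrow> x + y \<in> K" "\<And>x y. x \<in> K \<Longrightarrow> y \<in> K \<Longrightarrow> x - y \<in> K"
    "\<And>x y. x \<in> K \<Longrightarrow> y \<in> K \<Longrightarrow> x * y \<in> K" "\<And>x. x \<in> K \<Longrightarrow> inverse x \<in> K"
    by (rule countable_subfield_superset) blast
  obtain \<psi> where one: "\<psi> 1 = 1" and add: "\<And>x y. x \<in> K \<Longrightarrow> y \<in> K \<Longrightarrow> \<psi> (x + y) = \<psi> x + \<psi> y"
    and mult: "\<And>x y. x \<in> K \<Longrightarrow> y \<in> K \<Longrightarrow> \<psi> (x * y) = \<psi> x * \<psi> y"
    and rel: "\<And>J (a :: nat \<Rightarrow> complex) \<gamma>. \<lbrakk>\<And>i. i \<in> J \<Longrightarrow> \<gamma> i \<in> K; \<And>x. (\<Sum>i\<in>J. a i * f (\<gamma> i * x)) = 0\<rbrakk> \<Longrightarrow>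
      (\<Sum>i\<in>J. a i * \<psi> (\<gamma> i)) = 0"
    using additive_dilation_character[OF f(1,2) K(1,3,4,6)] by blast
  have diff: "\<psi> (x - y) = \<psi> x - \<psi> y" if "x \<in> K" "y \<in> K" for x y
    using add[OF K(5)[OF that] that(2)] by simp
  \<comment> \<open>For nonzero \<open>x\<close> the product of the values at \<open>x\<close> and
    at \<open>inverse x\<close> is 1, so the character is an embedding and its graph a partial
    isomorphism.\<close>
  have eq_0: "\<psi> x = 0 \<longleftrightarrow> x = 0" if "x \<in> K" for x
    using diff[OF that that] mult[OF that K(7)[OF that]] one by (cases "x = 0") auto
  define G where "G = (\<lambda>x. (x, \<psi> x)) ` K"
  have "partial_iso G"
    unfolding partial_iso_def G_def
    using K(3,5,6) one diff mult eq_0 by (auto simp: image_iff)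
  moreover have "countable G"
    using K(1) by (simp add: G_def)
  ultimately obtain \<phi> where \<phi>: "bij \<phi>" "\<phi> 1 = 1" "\<And>x y. \<phi> (x + y) = \<phi> x + \<phi> y"
    "\<And>x y. \<phi> (x * y) = \<phi> x * \<phi> y" "\<And>x y. (x, y) \<in> G \<Longrightarrow> \<phi> x = y"
    by (rule countable_partial_iso_extends_to_automorphism[OF uncountable_UNIV_complex]) blast
  \<comment> \<open>Setting one variable to zero splits the equation into one relation for the
    \<alpha> and one for the \<beta>, both of the form the character preserves.\<close>
  have "(\<Sum>i=1..n. a i * f (\<alpha> i * x)) = 0" "(\<Sum>i=1..n. a i * f (\<beta> i * x)) = 0" for x
    using f(3)[unfolded solves_on_def, rule_format, of x 0]
      f(3)[unfolded solves_on_def, rule_format, of 0 x] by simp_all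
  moreover have "\<alpha> i \<in> K" "\<beta> i \<in> K" if "i \<in> {1..n}" for i
    using K(2) that by blast+
  moreover have "\<phi> x = \<psi> x" if "x \<in> K" for x
    using \<phi>(5) that by (simp add: G_def)
  ultimately have "(\<Sum>i=1..n. a i * \<phi> (\<alpha> i)) = 0" "(\<Sum>i=1..n. a i * \<phi> (\<beta> i)) = 0"
    using rel[of "{1..n}" \<alpha> a] rel[of "{1..n}" \<beta> a] by simp_all
  with \<phi>(1-4) show thesis
    by (rule that)
qed

section \<open>The inhomogeneous equation\<close>

lemma inhomogeneous_solution_balance:
  assumes f: "solves_on UNIV n a \<alpha> \<beta> f c" and "c \<noteq> 0"
  shows "(\<Sum>i=1..n. a i * \<alpha> i) = (\<Sum>i=1..n. a i * \<beta> i)"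
proof -
  have \<alpha>: "(\<Sum>i=1..n. a i * f (\<alpha> i * x)) = c * x" and \<beta>: "(\<Sum>i=1..n. a i * f (\<beta> i * x)) = c * x" for x
    using f[unfolded solves_on_def, rule_format, of x 0]
      f[unfolded solves_on_def, rule_format, of 0 x] by simp_all
  have "c * (\<Sum>j=1..n. a j * \<beta> j) = (\<Sum>j=1..n. a j * (c * \<beta> j))"
    by (simp add: sum_distrib_left algebra_simps)
  \<comment> \<open>The \<alpha>-relation is used at the points \<open>\<beta> j\<close>; after the
    sums are exchanged, the \<beta>-relation applies at the points
    \<open>\<alpha> i\<close>.\<close>
  also have "\<dots> = (\<Sum>j=1..n. a j * (\<Sum>i=1..n. a i * f (\<alpha> i * \<beta> j)))"
    by (simp only: \<alpha>)
  also have "\<dots> = (\<Sum>i=1..n. a i * (\<Sum>j=1..n. a j * f (\<beta> j * \<alpha> i)))"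
    unfolding sum_distrib_left by (subst sum.swap) (simp add: algebra_simps)
  also have "\<dots> = (\<Sum>i=1..n. a i * (c * \<alpha> i))"
    by (simp only: \<beta>)
  also have "\<dots> = c * (\<Sum>i=1..n. a i * \<alpha> i)"
    by (simp add: sum_distrib_left algebra_simps)
  finally show ?thesis
    using \<open>c \<noteq> 0\<close> by simp
qed

section \<open>The field generated by the coefficients and the assembly of the conclusion\<close>

lemma generate_field_complex_closed:
  shows "1 \<in> generate_field complex_field S"
    and "S \<subseteq> generate_field complex_field S"
    and "x \<in> generate_field complex_field S \<Longrightarrow> y \<in> generate_field complex_field S \<Longrightarrow>
      x + y \<in> generate_field complex_field S"
    and "x \<in> generate_field complex_field S \<Longrightarrow> y \<in> generate_field complex_field S \<Longrightarrow>
      x * y \<in> generate_field complex_field S"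
  using generate_field.one[of complex_field S] generate_field.incl[where R = complex_field and H = S]
    generate_field.eng_add[of x complex_field S y] generate_field.eng_mult[of x complex_field S y]
  by (auto simp: ring_of_type_algebra_def)

text \<open>Additivity and multiplicativity of \<phi> reduce everything to the two coefficient sums.
  The right side becomes \<open>c'\<close> times the sum of the values of \<phi> at \<open>x\<close>
  and \<open>y\<close>, which is \<open>c' * (x + y)\<close> because either \<open>c'\<close> is
  zero or \<phi> is the identity.\<close>

lemma automorphism_conclusion:
  fixes a :: "nat \<Rightarrow> complex"
  assumes \<phi>: "bij \<phi>" "\<phi> 1 = 1" "\<And>x y. \<phi> (x + y) = \<phi> x + \<phi> y" "\<And>x y. \<phi> (x * y) = \<phi> x * \<phi> y"
    and sums: "(\<Sum>i=1..n. a i * \<phi> (\<alpha> i)) = c'" "(\<Sum>i=1..n. a i * \<phi> (\<beta> i)) = c'"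
    and id: "c' \<noteq> 0 \<Longrightarrow> \<phi> = id"
  shows "\<exists>K \<phi> c'. fin_gen_subfield K \<and>
         (\<forall>i\<in>{1..n}. \<alpha> i \<in> K \<and> \<beta> i \<in> K) \<and>
         \<phi> \<in> ring_iso complex_field complex_field \<and>
         restrict \<phi> (K - {0}) \<in> S1_star n a \<alpha> \<beta> K \<and>
         exponential (mult_group K) (restrict \<phi> (K - {0})) \<and>
         solves_on K n a \<alpha> \<beta> \<phi> c' \<and>
         (\<Sum>i=1..n. a i * \<phi> (\<alpha> i)) = c' \<and> (\<Sum>i=1..n. a i * \<phi> (\<beta> i)) = c' \<and>
         (c' = 0 \<longrightarrow>
            (\<forall>x y. (\<Sum>i=1..n. a i * \<phi> (\<alpha> i * x + \<beta> i * y)) = 0)) \<and>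
         (c' \<noteq> 0 \<longrightarrow>
            (\<forall>x\<in>K. \<phi> x = x) \<and>
            (\<Sum>i=1..n. a i * \<alpha> i) = c' \<and> (\<Sum>i=1..n. a i * \<beta> i) = c')"
proof -
  define S where "S = \<alpha> ` {1..n} \<union> \<beta> ` {1..n}"
  define K where "K = generate_field complex_field S"
  note K = generate_field_complex_closed[where S = S, folded K_def]
  have S: "\<alpha> i \<in> K" "\<beta> i \<in> K" if "i \<in> {1..n}" for i
    using K(2) that by (auto simp: S_def)
  have eq: "(\<Sum>i=1..n. a i * \<phi> (\<alpha> i * x + \<beta> i * y)) = c' * (x + y)" for x y
  proof -
    have "(\<Sum>i=1..n. a i * \<phi> (\<alpha> i * x + \<beta> i * y)) =
        (\<Sum>i=1..n. a i * \<phi> (\<alpha> i)) * \<phi> x + (\<Sum>i=1..n. a i * \<phi> (\<beta> i)) * \<phi> y"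
      by (simp add: \<phi>(3,4) sum_distrib_left sum.distrib algebra_simps)
    also have "\<dots> = c' * (\<phi> x + \<phi> y)"
      by (simp only: sums distrib_left)
    also have "\<dots> = c' * (x + y)"
      using id by (cases "c' = 0") simp_all
    finally show ?thesis .
  qed
  have "fin_gen_subfield K"
    unfolding fin_gen_subfield_def by (intro exI[of _ S]) (simp add: K_def S_def)
  moreover have "\<phi> \<in> ring_iso complex_field complex_field"
    using \<phi> by (auto simp: ring_iso_def ring_hom_def ring_of_type_algebra_def)
  moreover have "restrict \<phi> (K - {0}) \<in> S1_star n a \<alpha> \<beta> K"
    unfolding S1_star_def
  proof (rule image_eqI)
    \<comment> \<open>Members of \<open>S1\<close> are extensional on \<open>K\<close>, so the
      witness is \<phi> cut down to \<open>K\<close> first.\<close>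
    show "restrict \<phi> (K - {0}) = restrict (restrict \<phi> K) (K - {0})"
      by (simp add: fun_eq_iff restrict_def)
    have "solves_on K n a \<alpha> \<beta> (restrict \<phi> K) c'"
      unfolding solves_on_def
    proof (intro ballI)
      fix x y assume "x \<in> K" "y \<in> K"
      then have "(\<Sum>i=1..n. a i * restrict \<phi> K (\<alpha> i * x + \<beta> i * y)) =
          (\<Sum>i=1..n. a i * \<phi> (\<alpha> i * x + \<beta> i * y))"
        using S K(3,4) by (intro sum.cong) simp_all
      then show "(\<Sum>i=1..n. a i * restrict \<phi> K (\<alpha> i * x + \<beta> i * y)) = c' * (x + y)"
        using eq by simp
    qed
    then show "restrict \<phi> K \<in> S1 n a \<alpha> \<beta> K"
      using K(3) \<phi>(3) by (auto simp: S1_def V1_def)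
  qed
  moreover have "exponential (mult_group K) (restrict \<phi> (K - {0}))"
    unfolding exponential_def using K(1,4) \<phi>(2,4)
    by (auto simp: ring_of_type_algebra_def intro!: bexI[of _ 1])
  moreover have "solves_on K n a \<alpha> \<beta> \<phi> c'"
    using eq by (simp add: solves_on_def)
  moreover have "c' \<noteq> 0 \<Longrightarrow> (\<Sum>i=1..n. a i * \<alpha> i) = c' \<and> (\<Sum>i=1..n. a i * \<beta> i) = c' \<and> (\<forall>x\<in>K. \<phi> x = x)"
    using id sums by simp
  ultimately show ?thesis
    using S sums eq by (intro exI[of _ K] exI[of _ \<phi>] exI[of _ c']) auto
qed

theorem theorem3p3:
  fixes n :: nat and a \<alpha> \<beta> :: "nat \<Rightarrow> complex" and c :: complex
  assumes sum_nz: "\<And>i. i \<in> {1..n} \<Longrightarrow> \<alpha> i + \<beta> i \<noteq> 0"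
    and det_nz: "\<And>i j. i \<in> {1..n} \<Longrightarrow> j \<in> {1..n} \<Longrightarrow> i \<noteq> j \<Longrightarrow> \<alpha> i * \<beta> j - \<alpha> j * \<beta> i \<noteq> 0"
  shows
    "((\<exists>f :: complex \<Rightarrow> complex. additive f \<and> f \<noteq> (\<lambda>_. 0) \<and> solves_on UNIV n a \<alpha> \<beta> f c) \<longrightarrow>
      (\<exists>K \<phi> c'. fin_gen_subfield K \<and>
         (\<forall>i\<in>{1..n}. \<alpha> i \<in> K \<and> \<beta> i \<in> K) \<and>
         \<phi> \<in> ring_iso complex_field complex_field \<and>
         restrict \<phi> (K - {0}) \<in> S1_star n a \<alpha> \<beta> K \<and>
         exponential (mult_group K) (restrict \<phi> (K - {0})) \<and>
         solves_on K n a \<alpha> \<beta> \<phi> c' \<and>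
         (\<Sum>i=1..n. a i * \<phi> (\<alpha> i)) = c' \<and> (\<Sum>i=1..n. a i * \<phi> (\<beta> i)) = c' \<and>
         (c' = 0 \<longrightarrow>
            (\<forall>x y. (\<Sum>i=1..n. a i * \<phi> (\<alpha> i * x + \<beta> i * y)) = 0)) \<and>
         (c' \<noteq> 0 \<longrightarrow>
            (\<forall>x\<in>K. \<phi> x = x) \<and>
            (\<Sum>i=1..n. a i * \<alpha> i) = c' \<and> (\<Sum>i=1..n. a i * \<beta> i) = c'))) \<and>
     (\<forall>c'. c \<noteq> 0 \<and> (\<Sum>i=1..n. a i * \<alpha> i) = c' \<and> (\<Sum>i=1..n. a i * \<beta> i) = c' \<and> c' \<noteq> 0 \<longrightarrow>
        additive (\<lambda>x. c / c' * x) \<and> (\<lambda>x. c / c' * x) \<noteq> (\<lambda>_. 0) \<and>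
        solves_on UNIV n a \<alpha> \<beta> (\<lambda>x. c / c' * x) c)"
proof (intro conjI impI allI)
  assume "\<exists>f :: complex \<Rightarrow> complex. additive f \<and> f \<noteq> (\<lambda>_. 0) \<and> solves_on UNIV n a \<alpha> \<beta> f c"
  then obtain f :: "complex \<Rightarrow> complex" where
    f: "additive f" "f \<noteq> (\<lambda>_. 0)" "solves_on UNIV n a \<alpha> \<beta> f c"
    by blast
  show "\<exists>K \<phi> c'. fin_gen_subfield K \<and>
         (\<forall>i\<in>{1..n}. \<alpha> i \<in> K \<and> \<beta> i \<in> K) \<and>
         \<phi> \<in> ring_iso complex_field complex_field \<and>
         restrict \<phi> (K - {0}) \<in> S1_star n a \<alpha> \<beta> K \<and>
         exponential (mult_group K) (restrict \<phi> (K - {0})) \<and>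
         solves_on K n a \<alpha> \<beta> \<phi> c' \<and>
         (\<Sum>i=1..n. a i * \<phi> (\<alpha> i)) = c' \<and> (\<Sum>i=1..n. a i * \<phi> (\<beta> i)) = c' \<and>
         (c' = 0 \<longrightarrow>
            (\<forall>x y. (\<Sum>i=1..n. a i * \<phi> (\<alpha> i * x + \<beta> i * y)) = 0)) \<and>
         (c' \<noteq> 0 \<longrightarrow>
            (\<forall>x\<in>K. \<phi> x = x) \<and>
            (\<Sum>i=1..n. a i * \<alpha> i) = c' \<and> (\<Sum>i=1..n. a i * \<beta> i) = c')"
  proof (cases "c = 0")
    case True
    with f obtain \<phi> where "bij \<phi>" "\<phi> 1 = 1" "\<And>x y. \<phi> (x + y) = \<phi> x + \<phi> y"
      "\<And>x y. \<phi> (x * y) = \<phi> x * \<phi> y"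
      "(\<Sum>i=1..n. a i * \<phi> (\<alpha> i)) = 0" "(\<Sum>i=1..n. a i * \<phi> (\<beta> i)) = 0"
      using automorphism_from_homogeneous_solution[of f n a \<alpha> \<beta>] by blast
    then show ?thesis
      by (rule automorphism_conclusion) simp
  next
    case False
    \<comment> \<open>The identity is used whether or not the common sum vanishes; \<open>c'\<close>
      is that sum and need not equal \<open>c\<close>.\<close>
    then show ?thesis
      using inhomogeneous_solution_balance[OF f(3)]
      by (intro automorphism_conclusion[of id _ _ _ "\<Sum>i=1..n. a i * \<alpha> i"]) simp_all
  qed
next
  fix c' assume c': "c \<noteq> 0 \<and> (\<Sum>i=1..n. a i * \<alpha> i) = c' \<and> (\<Sum>i=1..n. a i * \<beta> i) = c' \<and> c' \<noteq> 0"
  show "additive (\<lambda>x. c / c' * x)"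
    by unfold_locales (rule distrib_left)
  show "(\<lambda>x. c / c' * x) \<noteq> (\<lambda>_. 0)"
    using c' by (auto simp: fun_eq_iff intro!: exI[of _ 1])
  show "solves_on UNIV n a \<alpha> \<beta> (\<lambda>x. c / c' * x) c"
    unfolding solves_on_def
  proof (intro ballI)
    fix x y
    have "(\<Sum>i=1..n. a i * (c / c' * (\<alpha> i * x + \<beta> i * y))) =
        c / c' * ((\<Sum>i=1..n. a i * \<alpha> i) * x + (\<Sum>i=1..n. a i * \<beta> i) * y)"
      by (simp add: sum_distrib_left sum_distrib_right sum.distrib algebra_simps)
    also have "\<dots> = c * (x + y)"
      using c' by (simp add: distrib_left)
    finally show "(\<Sum>i=1..n. a i * (c / c' * (\<alpha> i * x + \<beta> i * y))) = c * (x + y)" .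
  qed
qed

end
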